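(* Let $p>1$ and $1<Q_1\le Q_2$. Then there exist functions $u_1$ and $u_2$ on $(0,1)\subset\mathbf{R}$ such that $u_j$ is a $Q_j$-quasisuperminimizer in $(0,1)$, $j=1,2$, but $\min\{u_1,u_2\}$ is not a $Q_2$-quasisuperminimizer in $(0,1)$.
   Context: Let $1<p<\infty$, let $\Omega\subset\mathbf{R}^n$ be a nonempty open set and $Q\ge1$. A function $u\in W^{1,p}_{\rm loc}(\Omega)$ is a $Q$-quasisuperminimizer in $\Omega$ if $$\int_{\varphi\ne0}|\nabla u|^p\,dx\le Q\int_{\varphi\ne0}|\nabla(u+\varphi)|^p\,dx$$ for all nonnegative $\varphi\in W^{1,p}_0(\Omega)$, where the integrals are over $\{x\in\Omega:\varphi(x)\ne0\}$. Here the definition is used with $n=1$, $\Omega=(0,1)$ and the given exponent $p$. *)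

theory Defs
  imports "HOL-Analysis.Analysis"
begin

text \<open>
  Sobolev functions on an open set \<open>\<Omega>\<close> are represented by total functions on the
  ambient Euclidean space; only their values on \<open>\<Omega>\<close>, up to Lebesgue null sets, are relevant.
\<close>

primrec Ck :: "nat \<Rightarrow> ('a::euclidean_space \<Rightarrow> real) \<Rightarrow> bool" where
  "Ck 0 f \<longleftrightarrow> continuous_on UNIV f"
| "Ck (Suc k) f \<longleftrightarrow> (\<forall>x. f differentiable (at x)) \<and>
     (\<forall>b\<in>Basis. Ck k (\<lambda>x. frechet_derivative f (at x) b))"

definition test_function :: "'a::euclidean_space set \<Rightarrow> ('a \<Rightarrow> real) \<Rightarrow> bool" where
  "test_function \<Omega> \<eta> \<longleftrightarrow> (\<forall>k. Ck k \<eta>) \<and>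
     compact (closure {x. \<eta> x \<noteq> 0}) \<and> closure {x. \<eta> x \<noteq> 0} \<subseteq> \<Omega>"

definition in_Lp :: "real \<Rightarrow> 'a::euclidean_space set \<Rightarrow> ('a \<Rightarrow> 'b::euclidean_space) \<Rightarrow> bool" where
  "in_Lp p S f \<longleftrightarrow> set_borel_measurable lebesgue S f \<and>
     set_integrable lebesgue S (\<lambda>x. norm (f x) powr p)"

definition in_Lp_loc :: "real \<Rightarrow> 'a::euclidean_space set \<Rightarrow> ('a \<Rightarrow> 'b::euclidean_space) \<Rightarrow> bool" where
  "in_Lp_loc p \<Omega> f \<longleftrightarrow> (\<forall>K. compact K \<longrightarrow> K \<subseteq> \<Omega> \<longrightarrow> in_Lp p K f)"

definition has_weak_gradient ::
  "'a::euclidean_space set \<Rightarrow> ('a \<Rightarrow> real) \<Rightarrow> ('a \<Rightarrow> 'a) \<Rightarrow> bool" where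
  "has_weak_gradient \<Omega> u g \<longleftrightarrow> in_Lp_loc 1 \<Omega> u \<and> in_Lp_loc 1 \<Omega> g \<and>
     (\<forall>\<eta>. test_function \<Omega> \<eta> \<longrightarrow> (\<forall>b\<in>Basis.
        (LINT x:\<Omega>|lebesgue. u x * frechet_derivative \<eta> (at x) b) =
        - (LINT x:\<Omega>|lebesgue. (g x \<bullet> b) * \<eta> x)))"

text \<open>
  The weak gradient is unique up to null sets on open \<open>\<Omega>\<close>, so the choice of representative
  below does not affect integrals over subsets of \<open>\<Omega>\<close>. It is meaningful only for functions
  that possess a weak gradient, as all members of the Sobolev spaces below do.
\<close>

definition weak_grad :: "'a::euclidean_space set \<Rightarrow> ('a \<Rightarrow> real) \<Rightarrow> 'a \<Rightarrow> 'a" where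
  "weak_grad \<Omega> u = (SOME g. has_weak_gradient \<Omega> u g)"

definition W1p :: "real \<Rightarrow> 'a::euclidean_space set \<Rightarrow> ('a \<Rightarrow> real) set" where
  "W1p p \<Omega> = {u. in_Lp p \<Omega> u \<and> (\<exists>g. has_weak_gradient \<Omega> u g \<and> in_Lp p \<Omega> g)}"

definition W1p_loc :: "real \<Rightarrow> 'a::euclidean_space set \<Rightarrow> ('a \<Rightarrow> real) set" where
  "W1p_loc p \<Omega> = {u. in_Lp_loc p \<Omega> u \<and> (\<exists>g. has_weak_gradient \<Omega> u g \<and> in_Lp_loc p \<Omega> g)}"

text \<open>The \<open>p\<close>-th power of the Sobolev norm.\<close>

definition W1p_norm_pow :: "real \<Rightarrow> 'a::euclidean_space set \<Rightarrow> ('a \<Rightarrow> real) \<Rightarrow> ennreal" where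
  "W1p_norm_pow p \<Omega> u =
     (\<integral>\<^sup>+x\<in>\<Omega>. ennreal (\<bar>u x\<bar> powr p) \<partial>lebesgue) +
     (\<integral>\<^sup>+x\<in>\<Omega>. ennreal (norm (weak_grad \<Omega> u x) powr p) \<partial>lebesgue)"

text \<open>The closure of the test functions in \<open>W1p p \<Omega>\<close>.\<close>

definition W1p_0 :: "real \<Rightarrow> 'a::euclidean_space set \<Rightarrow> ('a \<Rightarrow> real) set" where
  "W1p_0 p \<Omega> = {u \<in> W1p p \<Omega>. \<exists>\<eta> :: nat \<Rightarrow> 'a \<Rightarrow> real.
     (\<forall>k. test_function \<Omega> (\<eta> k)) \<and>
     (\<lambda>k. W1p_norm_pow p \<Omega> (\<lambda>x. \<eta> k x - u x)) \<longlonglongrightarrow> 0}"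

text \<open>
  The energies are extended nonnegative integrals: \<open>\<bar>\<nabla>u\<bar>\<^sup>p\<close> is only locally integrable,
  so both sides of the inequality may be infinite.
\<close>

definition quasisuperminimizer ::
  "real \<Rightarrow> real \<Rightarrow> 'a::euclidean_space set \<Rightarrow> ('a \<Rightarrow> real) \<Rightarrow> bool" where
  "quasisuperminimizer p Q \<Omega> u \<longleftrightarrow> u \<in> W1p_loc p \<Omega> \<and>
     (\<forall>\<phi>\<in>W1p_0 p \<Omega>. (\<forall>x\<in>\<Omega>. 0 \<le> \<phi> x) \<longrightarrow>
        (\<integral>\<^sup>+x\<in>{x\<in>\<Omega>. \<phi> x \<noteq> 0}. ennreal (norm (weak_grad \<Omega> u x) powr p) \<partial>lebesgue)
        \<le> ennreal Q *
          (\<integral>\<^sup>+x\<in>{x\<in>\<Omega>. \<phi> x \<noteq> 0}.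
             ennreal (norm (weak_grad \<Omega> (\<lambda>y. u y + \<phi> y) x) powr p) \<partial>lebesgue))"

end

theory Submission
  imports Defs
begin

text \<open>
  A convex function \<open>u\<close> on an interval competes with its chord, and it is a \<open>Q\<close>-quasisuperminimizer
  when on no subinterval its energy exceeds \<open>Q\<close> times the energy of the chord. Comparing the \<open>p\<close>-th
  power with its tangent at a reference slope \<open>m\<close> turns this into a condition that is affine in the
  derivative \<open>u'\<close>: it suffices that for every subinterval there is some \<open>m\<close> for which the integral of
  \<open>\<bar>u'\<bar> powr p\<close> is at most \<open>Q\<close> times that of the tangent \<open>m powr p * (1 + p * (u' / m - 1))\<close>. This is the
  criterion \<open>quasisuperminimizerI\<close>. A perturbation \<open>\<phi>\<close> does not affect the integral of an affine
  function of the derivative over a component of the set where \<open>\<phi>\<close> is nonzero.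

  Two families satisfy the criterion. For the power \<open>u1 x = x * (x / d) powr \<delta>\<close> with small \<open>\<delta> > 0\<close>
  depending on \<open>Q1\<close>, the largest slope of the subinterval serves as \<open>m\<close>
  (\<open>quasisuperminimizer_power\<close>). For the second family take \<open>m = 1\<close> and let \<open>\<alpha> < 1 < \<beta>\<close> be the two
  points where the line \<open>Q2 * (1 + p * (x - 1))\<close> meets the \<open>p\<close>-th power (\<open>tangent_chord_slopes\<close>);
  a function whose slopes are \<open>\<alpha>\<close> and \<open>\<beta>\<close> only satisfies the criterion with equality. The function \<open>u2\<close>
  with slope \<open>\<alpha>\<close> on \<open>[0, d]\<close> and slope \<open>\<beta>\<close> on \<open>[d, 1]\<close>, where \<open>d\<close> is such that \<open>u2 1 = 1\<close>, is thus extremal: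
  its energy is exactly \<open>Q2\<close> times that of its chord, which has slope 1.

  The minimum destroys this balance. The power \<open>u1\<close> lies below \<open>u2\<close> on a short interval \<open>[0, y]\<close>, where
  \<open>u2\<close> is linear, agrees with it at both ends, and stays above \<open>u2\<close> afterwards, no matter how small \<open>\<delta>\<close> is,
  because the ratio of the slopes of \<open>u1\<close> at two points is unbounded. Passing from \<open>u2\<close> to the
  minimum replaces a linear piece by a strictly convex one with the same end values, which raises
  the energy but leaves the chord of the whole interval as it is. As \<open>u2\<close> had no energy to spare, the
  minimum is not a \<open>Q2\<close>-quasisuperminimizer, and the chord is a competitor that shows it.

  The rest relates Sobolev functions on the unit interval to calculus. Weak gradients are
  unique up to null sets (\<open>has_weak_gradient_unique\<close>), Lipschitz functions that vanish at both ends
  belong to \<open>W1p_0\<close> (\<open>bounded_primitive_in_W1p_0\<close>), and members of \<open>W1p_0\<close> have continuous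
  representatives that vanish at both ends and are primitives of their weak gradients
  (\<open>W1p_0_continuous_representative\<close>). The first two rest on the density of test functions
  (\<open>test_function_approximation\<close>).
\<close>

section \<open>Tangents of the power function\<close>

lemma powr_above_tangent_strict:
  fixes p x :: real
  assumes "1 < p" "0 < x" "x \<noteq> 1"
  shows "1 + p * (x - 1) < x powr p"
proof -
  have D: "((\<lambda>t. t powr p) has_real_derivative p * t powr (p - 1)) (at t)" if "t > 0" for t
    using that by (auto intro!: derivative_eq_intros)
  consider "1 < x" | "x < 1" using assms by linarith
  then show ?thesis
  proof cases
    case 1
    then obtain z where z: "1 < z" "x powr p - 1 powr p = (x - 1) * (p * z powr (p - 1))"
      using MVT2[of 1 x "\<lambda>t. t powr p" "\<lambda>t. p * t powr (p - 1)"] D by fastforce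
    have "1 < z powr (p - 1)" using z(1) assms by simp
    hence "(x - 1) * (p * 1) < (x - 1) * (p * z powr (p - 1))"
      using 1 assms by (intro mult_strict_left_mono) auto
    thus ?thesis using z by (simp add: algebra_simps)
  next
    case 2
    then obtain z where z: "x < z" "z < 1" "1 powr p - x powr p = (1 - x) * (p * z powr (p - 1))"
      using MVT2[of x 1 "\<lambda>t. t powr p" "\<lambda>t. p * t powr (p - 1)"] D assms by fastforce
    have "z powr (p - 1) < 1" using z(1,2) assms powr_less_mono2[of "p-1" z 1] by simp
    hence "(1 - x) * (p * z powr (p - 1)) < (1 - x) * (p * 1)"
      using 2 assms by (intro mult_strict_left_mono) auto
    thus ?thesis using z by (simp add: algebra_simps)
  qed
qed

text \<open>
  Convexity of the power, with the point of tangency \<open>m\<close> scaled to 1: in the applications \<open>m\<close> is a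
  reference slope and only the ratio \<open>x / m\<close> matters.
\<close>
lemma powr_above_tangent:
  fixes p x m :: real
  assumes "1 < p" "0 < m"
  shows "m powr p * (1 + p * (x / m - 1)) \<le> \<bar>x\<bar> powr p"
proof -
  have *: "1 + p * (t - 1) \<le> \<bar>t\<bar> powr p" for t
  proof (cases "t > 0")
    case True
    thus ?thesis using powr_above_tangent_strict[of p t] assms by (cases "t = 1") auto
  next
    case False
    hence "p * (t - 1) \<le> p * (-1)" using assms by (intro mult_left_mono) auto
    hence "1 + p * (t - 1) \<le> 0" using assms by linarith
    thus ?thesis by (smt (verit) powr_ge_zero)
  qed
  have "\<bar>x\<bar> powr p = m powr p * \<bar>x / m\<bar> powr p"
    using assms by (simp add: powr_divide)
  thus ?thesis using *[of "x / m"] by (simp add: mult_left_mono)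
qed

section \<open>Smooth functions of compact support\<close>

text \<open>
  The case \<open>j = 0\<close> is the classical smooth function that vanishes on the negative half-line. The
  whole family is needed because differentiation leads from index \<open>j\<close> to the indices \<open>j + 1\<close> and
  \<open>j + 2\<close>.
\<close>
definition flat :: "nat \<Rightarrow> real \<Rightarrow> real" where
  "flat j t = (if 0 < t then exp (- 1 / t) / t ^ j else 0)"

text \<open>
  At the origin the difference quotient of \<open>flat j\<close> is \<open>flat (j + 1)\<close>, which tends to 0 because the
  exponential beats every power.
\<close>
lemma flat_has_derivative:
  "(flat j has_real_derivative flat (j + 2) t - real j * flat (j + 1) t) (at t)"
proof -
  consider "t < 0" | "t = 0" | "0 < t" by linarith
  thus ?thesis
  proof cases
    case 1
    have "((\<lambda>_. 0) has_real_derivative 0) (at t)" by simp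
    hence "(flat j has_real_derivative 0) (at t)"
      by (rule has_field_derivative_transform_within_open[where S="{..<0}"]) (use 1 in \<open>auto simp: flat_def\<close>)
    thus ?thesis using 1 by (simp add: flat_def)
  next
    case 2
    have "((\<lambda>x::real. exp (- 1 / x) / x ^ (j+1)) \<longlongrightarrow> 0) (at_right 0)"
    proof -
      have "((\<lambda>x::real. x ^ (j+1) / exp x) \<longlongrightarrow> 0) at_top"
        by (rule tendsto_power_div_exp_0)
      hence "((\<lambda>x::real. inverse x ^ (j+1) / exp (inverse x)) \<longlongrightarrow> 0) (at_right 0)"
        by (rule filterlim_compose[OF _ filterlim_inverse_at_top_right])
      moreover have "(\<lambda>x::real. inverse x ^ (j+1) / exp (inverse x)) = (\<lambda>x. exp (- 1 / x) / x ^ (j+1))"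
        by (auto simp: fun_eq_iff field_simps exp_minus inverse_eq_divide power_divide)
      ultimately show ?thesis by simp
    qed
    hence "((\<lambda>x. (flat j (0 + x) - flat j 0) / x) \<longlongrightarrow> 0) (at_right 0)"
      by (rule Lim_transform_eventually)
        (auto simp: eventually_at_filter flat_def field_simps)
    moreover have "((\<lambda>x. (flat j (0 + x) - flat j 0) / x) \<longlongrightarrow> 0) (at_left 0)"
      by (rule Lim_transform_eventually[OF tendsto_const])
        (auto simp: eventually_at_filter flat_def field_simps)
    ultimately have "((\<lambda>x. (flat j (0 + x) - flat j 0) / x) \<longlongrightarrow> 0) (at 0)"
      by (simp add: filterlim_at_split)
    thus ?thesis using 2 by (simp add: DERIV_def flat_def)
  next
    case 3
    have "((\<lambda>t. exp (- 1 / t) / t ^ j) has_real_derivative flat (j + 2) t - real j * flat (j + 1) t) (at t)"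
      using 3 by (auto intro!: derivative_eq_intros simp: flat_def field_simps power2_eq_square)
        (cases j; simp add: field_simps)
    thus ?thesis
      by (rule has_field_derivative_transform_within_open[where S="{0<..}"]) (use 3 in \<open>auto simp: flat_def\<close>)
  qed
qed

text \<open>
  A class that contains its own derivatives, so that one induction makes every member smooth. The
  polynomial factor \<open>q\<close> leaves room for Weierstrass approximants, and \<open>r\<close> confines the support to
  the set where \<open>r\<close> is positive.
\<close>
inductive flat_poly :: "(real \<Rightarrow> real) \<Rightarrow> (real \<Rightarrow> real) \<Rightarrow> bool" for r where
  base: "real_polynomial_function q \<Longrightarrow> flat_poly r (\<lambda>x. q x * flat j (r x))"
| add: "flat_poly r f \<Longrightarrow> flat_poly r g \<Longrightarrow> flat_poly r (\<lambda>x. f x + g x)"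

lemma flat_poly_derivative:
  assumes "real_polynomial_function r" "flat_poly r f"
  shows "\<exists>f'. flat_poly r f' \<and> (\<forall>x. (f has_real_derivative f' x) (at x))"
  using assms(2)
proof induction
  case (base q j)
  obtain q' where q': "real_polynomial_function q'" "\<And>x. (q has_real_derivative q' x) (at x)"
    using has_real_derivative_polynomial_function[OF base] by blast
  obtain r' where r': "real_polynomial_function r'" "\<And>x. (r has_real_derivative r' x) (at x)"
    using has_real_derivative_polynomial_function[OF assms(1)] by blast
  let ?f = "\<lambda>x. q' x * flat j (r x) + (q x * r' x) * flat (j + 2) (r x)
      + (- real j * (q x * r' x)) * flat (j + 1) (r x)"
  have "flat_poly r ?f"
    by (intro flat_poly.intros q' r' base real_polynomial_function.intros)
  moreover have "((\<lambda>x. q x * flat j (r x)) has_real_derivative ?f x) (at x)" for x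
    by (rule derivative_eq_intros q' DERIV_chain2[OF flat_has_derivative] r' refl)+
      (simp add: algebra_simps)
  ultimately show ?case by blast
next
  case (add f g)
  then obtain f' g' where "flat_poly r f'" "\<forall>x. (f has_real_derivative f' x) (at x)"
    "flat_poly r g'" "\<forall>x. (g has_real_derivative g' x) (at x)" by blast
  thus ?case by (intro exI[of _ "\<lambda>x. f' x + g' x"]) (auto intro: flat_poly.add derivative_intros)
qed

lemma frechet_derivative_real:
  "(f has_real_derivative d) (at x) \<Longrightarrow> frechet_derivative f (at x) = (\<lambda>h. d * h)"
  by (metis frechet_derivative_at has_field_derivative_def)

lemma Ck_Suc_real:
  assumes "\<And>x. (f has_real_derivative f' x) (at x)" "Ck k f'"
  shows "Ck (Suc k) f"
  using assms by (auto simp: frechet_derivative_real[OF assms(1)] real_differentiable_def)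

lemma Ck_flat_poly:
  assumes "real_polynomial_function r" "flat_poly r f"
  shows "Ck k f"
  using assms(2)
proof (induction k arbitrary: f)
  case 0
  then obtain f' where "\<And>x. (f has_real_derivative f' x) (at x)"
    using flat_poly_derivative[OF assms(1)] by blast
  thus ?case by (auto intro!: continuous_at_imp_continuous_on intro: DERIV_isCont)
next
  case (Suc k)
  then show ?case using flat_poly_derivative[OF assms(1)] by (blast intro: Ck_Suc_real)
qed

lemma borel_measurable_lebesgueI: "f \<in> borel_measurable borel \<Longrightarrow> f \<in> borel_measurable lebesgue"
  by (intro measurable_completion) simp

text \<open>
  A measurable function is an almost everywhere limit of continuous ones. Clipping these to
  \<open>[- M, M]\<close>, replacing them by polynomials that are \<open>1 / (n + 1)\<close>-close on \<open>[a, b]\<close> (hence the bound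
  \<open>M + 1\<close>) and multiplying by the cut-off \<open>flat 0 (r n x)\<close> gives test functions. The argument
  \<open>r n x\<close> is positive only where \<open>(x - a) (b - x) \<ge> 1 / (n + 1)\<close>, which is a compact subset of the
  interval, and it tends to infinity at every interior point, where the cut-off thus tends to 1.
\<close>
lemma test_function_approximation:
  fixes h :: "real \<Rightarrow> real"
  assumes h: "h \<in> borel_measurable lebesgue" and M: "\<And>x. \<bar>h x\<bar> \<le> M"
  obtains \<psi> where "\<And>n. test_function {a<..<b} (\<psi> n)" "\<And>n x. \<bar>\<psi> n x\<bar> \<le> M + 1"
    "AE x in lebesgue. x \<in> {a<..<b} \<longrightarrow> (\<lambda>n. \<psi> n x) \<longlonglongrightarrow> h x"
proof -
  have "h measurable_on UNIV" using h by (rule lebesgue_measurable_imp_measurable_on_real) auto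
  then obtain N g where N: "negligible N" and g: "\<And>n. continuous_on UNIV (g n)"
    and lim: "\<And>x. x \<notin> N \<Longrightarrow> (\<lambda>n. g n x) \<longlonglongrightarrow> h x"
    by (auto simp: measurable_on_def)
  define g' where "g' n x = max (- M) (min M (g n x))" for n x
  have "\<exists>q. real_polynomial_function q \<and> (\<forall>x\<in>{a..b}. \<bar>g' n x - q x\<bar> < 1 / real (Suc n))" for n
  proof -
    have "continuous_on {a..b} (g' n)" unfolding g'_def
      by (intro continuous_intros continuous_on_subset[OF g]) auto
    then obtain f where "real_polynomial_function f" "\<And>x. x \<in> {a..b} \<Longrightarrow> \<bar>g' n x - f x\<bar> < 1 / real (Suc n)"
      using Stone_Weierstrass_real_polynomial_function[of "{a..b}" "g' n" "1 / real (Suc n)"] by auto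
    thus ?thesis by blast
  qed
  then obtain q where q: "\<And>n. real_polynomial_function (q n)"
    and qg: "\<And>n x. x \<in> {a..b} \<Longrightarrow> \<bar>g' n x - q n x\<bar> < 1 / real (Suc n)" by metis
  define r where "r n x = real (Suc n) * ((x - a) * (b - x)) - 1" for n x
  define \<psi> where "\<psi> n x = q n x * flat 0 (r n x)" for n x
  have M0: "0 \<le> M" using M[of 0] by linarith
  have r: "real_polynomial_function (r n)" for n
    unfolding r_def by (intro real_polynomial_function.intros(2,4) real_polynomial_function_diff
      real_polynomial_function.intros(1)[OF bounded_linear_ident])
  have flat01: "0 \<le> flat 0 t" "flat 0 t \<le> 1" for t by (auto simp: flat_def)
  have rpos: "1 / real (Suc n) \<le> (x - a) * (b - x)" if "0 < r n x" for n x
    using that by (simp add: r_def field_simps)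
  have sub: "{x. 1 / real (Suc n) \<le> (x - a) * (b - x)} \<subseteq> {a<..<b}" if "a < b" for n
  proof
    fix x assume "x \<in> {x. 1 / real (Suc n) \<le> (x - a) * (b - x)}"
    moreover have "0 < 1 / real (Suc n)" by simp
    ultimately have "0 < (x - a) * (b - x)" unfolding mem_Collect_eq by linarith
    thus "x \<in> {a<..<b}" using that by (auto simp: zero_less_mult_iff)
  qed
  show ?thesis
  proof (cases "a < b")
    case False
    have "Ck k (\<lambda>_::real. 0)" for k
      by (induction k) (auto simp: frechet_derivative_const)
    hence "test_function {a<..<b} (\<lambda>_. 0)" by (simp add: test_function_def)
    thus ?thesis using that[of "\<lambda>_ _. 0"] False M0 by simp
  next
    case True
    show ?thesis
    proof (rule that[of \<psi>])
      fix n
      have "Ck k (\<psi> n)" for k unfolding \<psi>_def[abs_def]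
        by (intro Ck_flat_poly[OF r[of n]] flat_poly.base q)
      moreover have cl: "closure {x. \<psi> n x \<noteq> 0} \<subseteq> {x. 1 / real (Suc n) \<le> (x - a) * (b - x)}"
      proof (rule closure_minimal)
        show "{x. \<psi> n x \<noteq> 0} \<subseteq> {x. 1 / real (Suc n) \<le> (x - a) * (b - x)}"
          using rpos by (fastforce simp: \<psi>_def flat_def split: if_splits)
        show "closed {x. 1 / real (Suc n) \<le> (x - a) * (b - x)}"
          by (intro closed_Collect_le continuous_intros)
      qed
      moreover have "bounded (closure {x. \<psi> n x \<noteq> 0})"
        by (rule bounded_subset[of "{a<..<b}"]) (use cl sub[OF True] in auto)
      ultimately show "test_function {a<..<b} (\<psi> n)"
        using sub[OF True, of n] by (auto simp: test_function_def compact_eq_bounded_closed)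
    next
      fix n x
      show "\<bar>\<psi> n x\<bar> \<le> M + 1"
      proof (cases "0 < r n x")
        case True
        hence x: "x \<in> {a..b}" using rpos[OF True] sub[OF \<open>a < b\<close>, of n] by fastforce
        have "\<bar>g' n x\<bar> \<le> M" using M0 by (auto simp: g'_def)
        moreover have "1 / real (Suc n) \<le> 1" by simp
        ultimately have "\<bar>q n x\<bar> \<le> M + 1" using qg[OF x, of n] by linarith
        hence "\<bar>q n x\<bar> * \<bar>flat 0 (r n x)\<bar> \<le> (M + 1) * 1"
          using flat01[of "r n x"] M0 by (intro mult_mono) auto
        thus ?thesis by (simp add: \<psi>_def abs_mult)
      qed (use M0 in \<open>auto simp: \<psi>_def flat_def\<close>)
    next
      have "(\<lambda>n. \<psi> n x) \<longlonglongrightarrow> h x" if x: "x \<in> {a<..<b}" "x \<notin> N" for x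
      proof -
        have "(\<lambda>n. g' n x) \<longlonglongrightarrow> max (- M) (min M (h x))"
          unfolding g'_def by (intro tendsto_intros lim x)
        moreover have "max (- M) (min M (h x)) = h x" using M[of x] by auto
        ultimately have g': "(\<lambda>n. g' n x) \<longlonglongrightarrow> h x" by simp
        have "(\<lambda>n. 1 / real (Suc n)) \<longlonglongrightarrow> 0"
          using LIMSEQ_inverse_real_of_nat by (simp add: inverse_eq_divide)
        hence "(\<lambda>n. g' n x - q n x) \<longlonglongrightarrow> 0"
          by (rule Lim_null_comparison[rotated]) (use less_imp_le[OF qg] x in \<open>auto intro!: always_eventually\<close>)
        from tendsto_diff[OF g' this] have qn: "(\<lambda>n. q n x) \<longlonglongrightarrow> h x" by simp
        have c: "0 < (x - a) * (b - x)" using x by simp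
        have "filterlim (\<lambda>n. real (Suc n) * ((x - a) * (b - x))) at_top sequentially"
          by (rule filterlim_at_top_mult_tendsto_pos[OF tendsto_const c])
            (rule filterlim_compose[OF filterlim_real_sequentially filterlim_Suc])
        hence rt: "filterlim (\<lambda>n. r n x) at_top sequentially"
          unfolding r_def by (subst diff_conv_add_uminus, subst add.commute)
            (intro filterlim_tendsto_add_at_top[OF tendsto_const])
        hence "(\<lambda>n. exp (- inverse (r n x))) \<longlonglongrightarrow> exp (- 0)"
          by (intro tendsto_intros tendsto_inverse_0_at_top)
        moreover have "\<forall>\<^sub>F n in sequentially. exp (- inverse (r n x)) = flat 0 (r n x)"
          using rt unfolding filterlim_at_top_dense
          by (rule eventually_mono[OF spec[of _ 0]]) (simp add: flat_def inverse_eq_divide)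
        ultimately have "(\<lambda>n. flat 0 (r n x)) \<longlonglongrightarrow> exp (- 0)"
          by (rule Lim_transform_eventually)
        hence "(\<lambda>n. flat 0 (r n x)) \<longlonglongrightarrow> 1" by simp
        from tendsto_mult[OF qn this] show ?thesis by (simp add: \<psi>_def)
      qed
      moreover have "AE x in lebesgue. x \<notin> N"
        using N by (intro AE_not_in) (simp add: negligible_iff_null_sets)
      ultimately show "AE x in lebesgue. x \<in> {a<..<b} \<longrightarrow> (\<lambda>n. \<psi> n x) \<longlonglongrightarrow> h x"
        by (auto elim!: eventually_mono)
    qed
  qed
qed

lemma test_function_mono: "test_function A \<eta> \<Longrightarrow> A \<subseteq> B \<Longrightarrow> test_function B \<eta>"
  by (auto simp: test_function_def)

lemma test_function_differentiable:
  fixes \<eta> :: "real \<Rightarrow> real"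
  assumes "test_function \<Omega> \<eta>"
  shows "\<exists>\<eta>'. \<forall>x. (\<eta> has_real_derivative \<eta>' x) (at x)"
proof -
  have "Ck (Suc 0) \<eta>" using assms unfolding test_function_def by blast
  hence "\<forall>x. \<exists>d. (\<eta> has_real_derivative d) (at x)" by (simp add: real_differentiable_def)
  thus ?thesis by (rule choice)
qed

lemma test_functionD:
  fixes \<eta> :: "real \<Rightarrow> real"
  assumes "test_function \<Omega> \<eta>" and D: "\<And>x. (\<eta> has_real_derivative \<eta>' x) (at x)"
  shows "continuous_on UNIV \<eta>" "continuous_on UNIV \<eta>'"
    "compact (closure {x. \<eta> x \<noteq> 0})" "closure {x. \<eta> x \<noteq> 0} \<subseteq> \<Omega>"
    "\<And>x. x \<notin> closure {x. \<eta> x \<noteq> 0} \<Longrightarrow> \<eta> x = 0" "\<And>x. x \<notin> closure {x. \<eta> x \<noteq> 0} \<Longrightarrow> \<eta>' x = 0"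
proof -
  let ?K = "closure {x. \<eta> x \<noteq> 0}"
  have "Ck (Suc 0) \<eta>" "Ck 0 \<eta>" using assms unfolding test_function_def by blast+
  thus "continuous_on UNIV \<eta>" "continuous_on UNIV \<eta>'" by (auto simp: frechet_derivative_real[OF D])
  show "compact ?K" "?K \<subseteq> \<Omega>" using assms by (auto simp: test_function_def)
  show z: "\<eta> x = 0" if "x \<notin> ?K" for x using that closure_subset[of "{x. \<eta> x \<noteq> 0}"] by blast
  show "\<eta>' x = 0" if "x \<notin> ?K" for x
  proof (rule DERIV_unique[OF D])
    have "((\<lambda>_. 0) has_real_derivative 0) (at x)" by simp
    thus "(\<eta> has_real_derivative 0) (at x)"
    proof (rule has_field_derivative_transform_within_open[where S="- ?K"])
      show "0 = \<eta> y" if "y \<in> - ?K" for y using z[of y] that by simp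
      show "open (- ?K)" by (rule open_Compl) simp
    qed (use that in simp_all)
  qed
qed

section \<open>Weak gradients on an interval\<close>

lemma in_Lp_loc_1D:
  fixes g :: "real \<Rightarrow> real"
  assumes "in_Lp_loc 1 \<Omega> g" "compact K" "K \<subseteq> \<Omega>"
  shows "set_integrable lebesgue K g"
proof -
  have "set_borel_measurable lebesgue K g" "set_integrable lebesgue K (\<lambda>x. \<bar>g x\<bar>)"
    using assms by (auto simp: in_Lp_loc_def in_Lp_def)
  thus ?thesis by (simp add: set_integrable_abs_iff)
qed

lemma set_integrable_mult_compact_support:
  fixes g \<eta> :: "real \<Rightarrow> real"
  assumes g: "in_Lp_loc 1 \<Omega> g" and K: "compact K" "K \<subseteq> \<Omega>"
    and \<eta>: "continuous_on UNIV \<eta>" "\<And>x. x \<notin> K \<Longrightarrow> \<eta> x = 0"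
  shows "set_integrable lebesgue \<Omega> (\<lambda>x. g x * \<eta> x)"
proof -
  have "bounded (\<eta> ` K)" by (intro compact_imp_bounded compact_continuous_image continuous_on_subset[OF \<eta>(1)] K) simp
  then obtain B where B: "\<And>x. x \<in> K \<Longrightarrow> \<bar>\<eta> x\<bar> \<le> B" by (auto simp: bounded_iff)
  have [measurable]: "\<eta> \<in> borel_measurable lebesgue"
    using \<eta>(1) by (intro borel_measurable_lebesgueI borel_measurable_continuous_onI)
  have i: "integrable lebesgue (\<lambda>x. indicator K x * g x)"
    using in_Lp_loc_1D[OF g K] by (simp add: set_integrable_def)
  have eq: "indicator \<Omega> x *\<^sub>R (g x * \<eta> x) = (indicator K x * g x) * \<eta> x" for x
    using \<eta>(2)[of x] K by (auto simp: indicator_def)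
  show ?thesis unfolding set_integrable_def eq
  proof (rule Bochner_Integration.integrable_bound)
    show "integrable lebesgue (\<lambda>x. B * (indicator K x * g x))" using i by simp
    show "(\<lambda>x. (indicator K x * g x) * \<eta> x) \<in> borel_measurable lebesgue"
      using borel_measurable_integrable[OF i] by measurable
    have "\<bar>\<eta> x\<bar> * \<bar>g x\<bar> \<le> \<bar>B\<bar> * \<bar>g x\<bar>" if "x \<in> K" for x using B[OF that] by (intro mult_right_mono) auto
    thus "AE x in lebesgue. norm ((indicator K x * g x) * \<eta> x) \<le> norm (B * (indicator K x * g x))"
      by (auto simp: indicator_def abs_mult mult.commute)
  qed
qed

lemma has_weak_gradient_realD:
  fixes u g :: "real \<Rightarrow> real"
  assumes "has_weak_gradient \<Omega> u g" "test_function \<Omega> \<eta>" "\<And>x. (\<eta> has_real_derivative \<eta>' x) (at x)"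
  shows "set_integrable lebesgue \<Omega> (\<lambda>x. u x * \<eta>' x)" "set_integrable lebesgue \<Omega> (\<lambda>x. g x * \<eta> x)"
    "(LINT x:\<Omega>|lebesgue. u x * \<eta>' x) = - (LINT x:\<Omega>|lebesgue. g x * \<eta> x)"
proof -
  note * = test_functionD[OF assms(2,3)]
  have u: "in_Lp_loc 1 \<Omega> u" and g: "in_Lp_loc 1 \<Omega> g" using assms(1) by (auto simp: has_weak_gradient_def)
  show "set_integrable lebesgue \<Omega> (\<lambda>x. u x * \<eta>' x)"
    by (rule set_integrable_mult_compact_support[OF u *(3,4,2,6)])
  show "set_integrable lebesgue \<Omega> (\<lambda>x. g x * \<eta> x)"
    by (rule set_integrable_mult_compact_support[OF g *(3,4,1,5)])
  show "(LINT x:\<Omega>|lebesgue. u x * \<eta>' x) = - (LINT x:\<Omega>|lebesgue. g x * \<eta> x)"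
  proof -
    have "(LINT x:\<Omega>|lebesgue. u x * frechet_derivative \<eta> (at x) 1) = - (LINT x:\<Omega>|lebesgue. g x * \<eta> x)"
      using assms(1,2) by (simp add: has_weak_gradient_def)
    thus ?thesis by (simp add: frechet_derivative_real[OF assms(3)])
  qed
qed

lemma has_weak_gradient_realI:
  fixes u g :: "real \<Rightarrow> real"
  assumes "in_Lp_loc 1 \<Omega> u" "in_Lp_loc 1 \<Omega> g"
    and "\<And>\<eta> \<eta>'. test_function \<Omega> \<eta> \<Longrightarrow> (\<And>x. (\<eta> has_real_derivative \<eta>' x) (at x)) \<Longrightarrow>
       (LINT x:\<Omega>|lebesgue. u x * \<eta>' x) = - (LINT x:\<Omega>|lebesgue. g x * \<eta> x)"
  shows "has_weak_gradient \<Omega> u g"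
proof -
  have "(LINT x:\<Omega>|lebesgue. u x * frechet_derivative \<eta> (at x) b) = - (LINT x:\<Omega>|lebesgue. g x \<bullet> b * \<eta> x)"
    if t: "test_function \<Omega> \<eta>" and b: "b \<in> Basis" for \<eta> b
  proof -
    obtain \<eta>' where *: "\<And>x. (\<eta> has_real_derivative \<eta>' x) (at x)"
      using test_function_differentiable[OF t] by blast
    show ?thesis using assms(3)[OF t *] b by (simp add: frechet_derivative_real[OF *])
  qed
  thus ?thesis using assms(1,2) by (simp add: has_weak_gradient_def)
qed

lemma in_Lp_locI:
  assumes "set_borel_measurable lebesgue \<Omega> f"
   and "\<And>K. compact K \<Longrightarrow> K \<subseteq> \<Omega> \<Longrightarrow> set_integrable lebesgue K (\<lambda>x. norm (f x) powr p)"
  shows "in_Lp_loc p \<Omega> f"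
  unfolding in_Lp_loc_def in_Lp_def
proof (intro allI impI conjI assms)
  fix K :: "'a set" assume K: "compact K" "K \<subseteq> \<Omega>"
  have "K \<in> sets lebesgue" using K by (simp add: lmeasurable_compact fmeasurableD)
  hence "(\<lambda>x. indicator K x *\<^sub>R (indicator \<Omega> x *\<^sub>R f x)) \<in> borel_measurable lebesgue"
    using assms(1) unfolding set_borel_measurable_def by measurable
  moreover have "(\<lambda>x. indicator K x *\<^sub>R (indicator \<Omega> x *\<^sub>R f x)) = (\<lambda>x. indicator K x *\<^sub>R f x)"
    using K by (auto simp: indicator_def fun_eq_iff)
  ultimately show "set_borel_measurable lebesgue K f" by (simp add: set_borel_measurable_def)
qed

lemma in_Lp_loc_1_iff:
  fixes g :: "real \<Rightarrow> real"
  shows "in_Lp_loc 1 \<Omega> g \<longleftrightarrow> (\<forall>K. compact K \<longrightarrow> K \<subseteq> \<Omega> \<longrightarrow> set_integrable lebesgue K g)"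
proof
  assume "\<forall>K. compact K \<longrightarrow> K \<subseteq> \<Omega> \<longrightarrow> set_integrable lebesgue K g"
  hence "set_integrable lebesgue K g" if "compact K" "K \<subseteq> \<Omega>" for K using that by blast
  thus "in_Lp_loc 1 \<Omega> g"
    by (auto simp: in_Lp_loc_def in_Lp_def set_borel_measurable_def set_integrable_def
      dest: borel_measurable_integrable intro: set_integrable_abs[unfolded set_integrable_def real_scaleR_def])
qed (use in_Lp_loc_1D in blast)

lemma has_weak_gradient_add:
  fixes u v g h :: "real \<Rightarrow> real"
  assumes "has_weak_gradient \<Omega> u g" "has_weak_gradient \<Omega> v h"
  shows "has_weak_gradient \<Omega> (\<lambda>x. u x + v x) (\<lambda>x. g x + h x)"
proof (rule has_weak_gradient_realI)
  show "in_Lp_loc 1 \<Omega> (\<lambda>x. u x + v x)" "in_Lp_loc 1 \<Omega> (\<lambda>x. g x + h x)"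
    using assms by (auto simp: has_weak_gradient_def in_Lp_loc_1_iff)
  show "(LINT x:\<Omega>|lebesgue. (u x + v x) * \<eta>' x) = - (LINT x:\<Omega>|lebesgue. (g x + h x) * \<eta> x)"
    if "test_function \<Omega> \<eta>" "\<And>x. (\<eta> has_real_derivative \<eta>' x) (at x)" for \<eta> \<eta>'
    using has_weak_gradient_realD[OF assms(1) that] has_weak_gradient_realD[OF assms(2) that]
    by (simp add: distrib_right)
qed

lemma has_weak_gradient_diff:
  fixes u v g h :: "real \<Rightarrow> real"
  assumes "has_weak_gradient \<Omega> u g" "has_weak_gradient \<Omega> v h"
  shows "has_weak_gradient \<Omega> (\<lambda>x. u x - v x) (\<lambda>x. g x - h x)"
proof (rule has_weak_gradient_realI)
  show "in_Lp_loc 1 \<Omega> (\<lambda>x. u x - v x)" "in_Lp_loc 1 \<Omega> (\<lambda>x. g x - h x)"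
    using assms by (auto simp: has_weak_gradient_def in_Lp_loc_1_iff)
  show "(LINT x:\<Omega>|lebesgue. (u x - v x) * \<eta>' x) = - (LINT x:\<Omega>|lebesgue. (g x - h x) * \<eta> x)"
    if "test_function \<Omega> \<eta>" "\<And>x. (\<eta> has_real_derivative \<eta>' x) (at x)" for \<eta> \<eta>'
    using has_weak_gradient_realD[OF assms(1) that] has_weak_gradient_realD[OF assms(2) that]
    by (simp add: left_diff_distrib)
qed

text \<open>
  The fundamental lemma of the calculus of variations: testing with bounded approximations of the
  sign of \<open>g\<close> gives the integral of \<open>\<bar>g\<bar>\<close> in the limit.
\<close>
lemma AE_zero_if_orthogonal_to_test_functions:
  fixes g :: "real \<Rightarrow> real"
  assumes g: "set_integrable lebesgue {a<..<b} g"
    and orth: "\<And>\<eta>. test_function {a<..<b} \<eta> \<Longrightarrow> (LINT x:{a<..<b}|lebesgue. g x * \<eta> x) = 0"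
  shows "AE x in lebesgue. x \<in> {a<..<b} \<longrightarrow> g x = 0"
proof -
  let ?S = "{a<..<b}"
  let ?g = "\<lambda>x. indicator ?S x * g x"
  have i: "integrable lebesgue ?g" using g by (simp add: set_integrable_def)
  have [measurable]: "?g \<in> borel_measurable lebesgue" using i by simp
  have "(\<lambda>x. sgn (?g x)) \<in> borel_measurable lebesgue" by measurable
  then obtain \<psi> where \<psi>: "\<And>n. test_function ?S (\<psi> n)" "\<And>n x. \<bar>\<psi> n x\<bar> \<le> 1 + 1"
    and lim: "AE x in lebesgue. x \<in> ?S \<longrightarrow> (\<lambda>n. \<psi> n x) \<longlonglongrightarrow> sgn (?g x)"
    using test_function_approximation[of "\<lambda>x. sgn (?g x)" 1 a b] by (auto simp: abs_sgn_eq)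
  have [measurable]: "\<psi> n \<in> borel_measurable lebesgue" for n
    using \<psi>(1)[of n] by (intro borel_measurable_lebesgueI borel_measurable_continuous_onI)
      (auto simp: test_function_def dest: spec[of _ 0])
  have "(\<lambda>n. LINT x|lebesgue. ?g x * \<psi> n x) \<longlonglongrightarrow> (LINT x|lebesgue. \<bar>?g x\<bar>)"
  proof (rule integral_dominated_convergence)
    show "integrable lebesgue (\<lambda>x. 2 * \<bar>?g x\<bar>)" using i by simp
    show "AE x in lebesgue. (\<lambda>n. ?g x * \<psi> n x) \<longlonglongrightarrow> \<bar>?g x\<bar>"
      using lim
    proof eventually_elim
      case (elim x)
      show ?case
      proof (cases "x \<in> ?S")
        case True
        hence "(\<lambda>n. ?g x * \<psi> n x) \<longlonglongrightarrow> ?g x * sgn (?g x)" using elim by (intro tendsto_intros) auto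
        thus ?thesis by (simp add: abs_sgn)
      qed simp
    qed
    show "AE x in lebesgue. norm (?g x * \<psi> n x) \<le> 2 * \<bar>?g x\<bar>" for n
    proof (rule AE_I2)
      fix x
      have "\<bar>?g x\<bar> * \<bar>\<psi> n x\<bar> \<le> \<bar>?g x\<bar> * 2" using \<psi>(2)[of n x] by (intro mult_left_mono) auto
      thus "norm (?g x * \<psi> n x) \<le> 2 * \<bar>?g x\<bar>" by (simp add: abs_mult)
    qed
  qed measurable
  moreover have "(LINT x|lebesgue. ?g x * \<psi> n x) = 0" for n
    using orth[OF \<psi>(1)[of n]] by (simp add: set_lebesgue_integral_def mult.assoc)
  ultimately have "(LINT x|lebesgue. \<bar>?g x\<bar>) = 0"
    using LIMSEQ_unique[OF tendsto_const] by fastforce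
  hence "AE x in lebesgue. \<bar>?g x\<bar> = 0"
    using integral_nonneg_eq_0_iff_AE[of lebesgue "\<lambda>x. \<bar>?g x\<bar>"] i by simp
  thus ?thesis by eventually_elim (auto simp: indicator_def)
qed

text \<open>
  Weak gradients are integrable only locally, so the fundamental lemma is applied on an exhausting
  sequence of intervals.
\<close>
lemma has_weak_gradient_unique:
  fixes u g h :: "real \<Rightarrow> real"
  assumes g: "has_weak_gradient {a<..<b} u g" and h: "has_weak_gradient {a<..<b} u h"
  shows "AE x in lebesgue. x \<in> {a<..<b} \<longrightarrow> g x = h x"
proof -
  let ?\<Omega> = "{a<..<b}"
  define S where "S n = {a + 1 / real (Suc n)<..<b - 1 / real (Suc n)}" for n
  have "AE x in lebesgue. x \<in> S n \<longrightarrow> g x - h x = 0" for n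
    unfolding S_def
  proof (rule AE_zero_if_orthogonal_to_test_functions, fold S_def)
    have sub: "{a + 1 / real (Suc n)..b - 1 / real (Suc n)} \<subseteq> ?\<Omega>"
    proof
      fix x assume "x \<in> {a + 1 / real (Suc n)..b - 1 / real (Suc n)}"
      moreover have "0 < 1 / real (Suc n)" by simp
      ultimately show "x \<in> ?\<Omega>" unfolding atLeastAtMost_iff greaterThanLessThan_iff by linarith
    qed
    have "set_integrable lebesgue {a + 1 / real (Suc n)..b - 1 / real (Suc n)} (\<lambda>x. g x - h x)"
      using g h sub by (intro set_integral_diff in_Lp_loc_1D[of ?\<Omega>]) (auto simp: has_weak_gradient_def)
    thus "set_integrable lebesgue (S n) (\<lambda>x. g x - h x)"
      by (rule set_integrable_subset) (auto simp: S_def)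
    fix \<eta> assume t: "test_function (S n) \<eta>"
    have sub': "S n \<subseteq> ?\<Omega>" unfolding S_def by (rule subset_trans[OF _ sub]) auto
    hence t': "test_function ?\<Omega> \<eta>" using t test_function_mono by blast
    obtain \<eta>' where D: "\<And>x. (\<eta> has_real_derivative \<eta>' x) (at x)"
      using test_function_differentiable[OF t] by blast
    have "(LINT x:?\<Omega>|lebesgue. (g x - h x) * \<eta> x) = 0"
      using has_weak_gradient_realD[OF g t' D] has_weak_gradient_realD[OF h t' D]
      by (simp add: left_diff_distrib)
    moreover have "indicator ?\<Omega> x *\<^sub>R ((g x - h x) * \<eta> x) = indicator (S n) x *\<^sub>R ((g x - h x) * \<eta> x)" for x
    proof (cases "x \<in> S n")
      case True thus ?thesis using sub' by (auto simp: indicator_def)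
    next
      case False
      have "\<eta> x = 0" by (rule test_functionD(5)[OF t D]) (use False test_functionD(4)[OF t D] in blast)
      thus ?thesis by simp
    qed
    ultimately show "(LINT x:S n|lebesgue. (g x - h x) * \<eta> x) = 0"
      by (simp only: set_lebesgue_integral_def)
  qed
  hence "AE x in lebesgue. \<forall>n. x \<in> S n \<longrightarrow> g x - h x = 0" by (intro AE_all_countable[THEN iffD2] allI)
  thus ?thesis
  proof eventually_elim
    case (elim x)
    show ?case
    proof
      assume x: "x \<in> ?\<Omega>"
      hence "0 < min (x - a) (b - x)" by simp
      then obtain n where "1 / real (Suc n) < min (x - a) (b - x)" by (rule nat_approx_posE)
      hence "x \<in> S n" by (auto simp: S_def)
      thus "g x = h x" using elim by auto
    qed
  qed
qed

lemma weak_grad_AE_eq: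
  fixes u g :: "real \<Rightarrow> real"
  assumes "has_weak_gradient {a<..<b} u g"
  shows "AE x in lebesgue. x \<in> {a<..<b} \<longrightarrow> weak_grad {a<..<b} u x = g x"
  unfolding weak_grad_def
  by (rule has_weak_gradient_unique[OF someI[of "has_weak_gradient {a<..<b} u"] assms]) (rule assms)

section \<open>Functions with bounded derivative\<close>

lemma set_integrable_bounded:
  fixes f :: "real \<Rightarrow> real"
  assumes "set_borel_measurable lebesgue {a<..<b} f" "\<And>x. x \<in> {a<..<b} \<Longrightarrow> \<bar>f x\<bar> \<le> M"
  shows "set_integrable lebesgue {a<..<b} f"
  unfolding set_integrable_def
proof (rule Bochner_Integration.integrable_bound)
  have "{a<..<b} \<in> lmeasurable" by simp
  thus "integrable lebesgue (\<lambda>x. indicator {a<..<b} x * M)"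
    by (intro integrable_mult_left) (simp add: fmeasurable_def)
  show "AE x in lebesgue. norm (indicator {a<..<b} x *\<^sub>R f x) \<le> norm (indicator {a<..<b} x * M)"
    using assms(2) by (intro AE_I2) (force simp: indicator_def)
qed (use assms(1) in \<open>simp add: set_borel_measurable_def\<close>)

text \<open>
  A convenient form of: \<open>u\<close> is Lipschitz on the closed unit interval with derivative \<open>g\<close>.
  Differentiability off a finite set together with continuity up to the endpoints is what the
  fundamental theorem of calculus asks for, and all explicit functions below have this form.
\<close>
definition bounded_primitive :: "(real \<Rightarrow> real) \<Rightarrow> (real \<Rightarrow> real) \<Rightarrow> bool" where
  "bounded_primitive u g \<longleftrightarrow> continuous_on {0..1} u \<and>
     set_borel_measurable lebesgue {0<..<1} g \<and> (\<exists>M. \<forall>x\<in>{0<..<1}. \<bar>g x\<bar> \<le> M) \<and>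
     (\<exists>S. finite S \<and> (\<forall>x\<in>{0<..<1} - S. (u has_real_derivative g x) (at x)))"

lemma bounded_primitive_integral:
  assumes u: "bounded_primitive u g" and ab: "0 \<le> a" "a \<le> b" "b \<le> 1"
  shows "set_integrable lebesgue {a<..<b} g" "(LINT x:{a<..<b}|lebesgue. g x) = u b - u a"
proof -
  obtain M S where M: "\<forall>x\<in>{0<..<1}. \<bar>g x\<bar> \<le> M" and S: "finite S"
    "\<forall>x\<in>{0<..<1} - S. (u has_real_derivative g x) (at x)"
    using u by (auto simp: bounded_primitive_def)
  have "set_integrable lebesgue {0<..<1} g"
    using u M by (intro set_integrable_bounded) (auto simp: bounded_primitive_def)
  thus i: "set_integrable lebesgue {a<..<b} g"
    by (rule set_integrable_subset) (use ab in auto)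
  have "(g has_integral (u b - u a)) {a..b}"
  proof (rule fundamental_theorem_of_calculus_interior_strong[OF S(1) ab(2)])
    show "continuous_on {a..b} u" using u ab by (auto simp: bounded_primitive_def elim: continuous_on_subset)
  qed (use S(2) ab in \<open>auto simp: has_real_derivative_iff_has_vector_derivative[symmetric]\<close>)
  hence "(g has_integral (u b - u a)) {a<..<b}" by (simp add: has_integral_Icc_iff_Ioo)
  thus "(LINT x:{a<..<b}|lebesgue. g x) = u b - u a"
    using has_integral_set_lebesgue[OF i] has_integral_unique by blast
qed

lemma bounded_primitive_diff:
  assumes "bounded_primitive u g" "bounded_primitive v h"
  shows "bounded_primitive (\<lambda>x. u x - v x) (\<lambda>x. g x - h x)"
  unfolding bounded_primitive_def
proof (intro conjI)
  show "continuous_on {0..1} (\<lambda>x. u x - v x)" using assms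
    by (auto simp: bounded_primitive_def intro: continuous_intros)
  show "set_borel_measurable lebesgue {0<..<1} (\<lambda>x. g x - h x)"
    using assms by (auto simp: bounded_primitive_def set_borel_measurable_def right_diff_distrib)
  obtain M N where "\<forall>x\<in>{0<..<1}. \<bar>g x\<bar> \<le> M" "\<forall>x\<in>{0<..<1}. \<bar>h x\<bar> \<le> N"
    using assms by (auto simp: bounded_primitive_def)
  thus "\<exists>M. \<forall>x\<in>{0<..<1}. \<bar>g x - h x\<bar> \<le> M" by (intro exI[of _ "M + N"]) fastforce
  obtain S T where "finite S" "\<forall>x\<in>{0<..<1} - S. (u has_real_derivative g x) (at x)"
    "finite T" "\<forall>x\<in>{0<..<1} - T. (v has_real_derivative h x) (at x)"
    using assms by (auto simp: bounded_primitive_def)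
  thus "\<exists>S. finite S \<and> (\<forall>x\<in>{0<..<1} - S. ((\<lambda>x. u x - v x) has_real_derivative g x - h x) (at x))"
    by (intro exI[of _ "S \<union> T"]) (auto intro!: derivative_intros)
qed

lemma set_borel_measurable_continuous_Ioo:
  fixes f :: "real \<Rightarrow> real"
  assumes "continuous_on {0..1} f"
  shows "set_borel_measurable lebesgue {0<..<1} f"
  unfolding set_borel_measurable_def
  by (intro borel_measurable_lebesgueI borel_measurable_continuous_on_indicator continuous_on_subset[OF assms]) auto

lemma continuous_on_Icc_bounded:
  fixes f :: "real \<Rightarrow> real"
  assumes "continuous_on {0..1} f"
  shows "\<exists>M. \<forall>x\<in>{0..1}. \<bar>f x\<bar> \<le> M"
  using compact_imp_bounded[OF compact_continuous_image[OF assms]] by (auto simp: bounded_iff)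

lemma bounded_primitive_mult:
  assumes u: "bounded_primitive u g" and v: "bounded_primitive v h"
  shows "bounded_primitive (\<lambda>x. u x * v x) (\<lambda>x. g x * v x + u x * h x)"
  unfolding bounded_primitive_def
proof (intro conjI)
  note def = bounded_primitive_def
  have c: "continuous_on {0..1} u" "continuous_on {0..1} v" using u v by (auto simp: def)
  thus "continuous_on {0..1} (\<lambda>x. u x * v x)" by (intro continuous_intros)
  let ?I = "indicator {0<..<1} :: real \<Rightarrow> real"
  have "(\<lambda>x. (?I x * g x) * (?I x * v x) + (?I x * u x) * (?I x * h x)) \<in> borel_measurable lebesgue"
    using u v c[THEN set_borel_measurable_continuous_Ioo]
    by (auto simp: def set_borel_measurable_def intro!: borel_measurable_add borel_measurable_times)
  moreover have "(?I x * g x) * (?I x * v x) + (?I x * u x) * (?I x * h x) = ?I x *\<^sub>R (g x * v x + u x * h x)" for x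
    by (auto simp: indicator_def)
  ultimately show "set_borel_measurable lebesgue {0<..<1} (\<lambda>x. g x * v x + u x * h x)"
    by (simp add: set_borel_measurable_def)
  obtain M N where MN: "\<forall>x\<in>{0<..<1}. \<bar>g x\<bar> \<le> M" "\<forall>x\<in>{0<..<1}. \<bar>h x\<bar> \<le> N"
    using assms by (auto simp: def)
  obtain A B where AB: "\<forall>x\<in>{0..1}. \<bar>u x\<bar> \<le> A" "\<forall>x\<in>{0..1}. \<bar>v x\<bar> \<le> B"
    using c[THEN continuous_on_Icc_bounded] by auto
  have "\<bar>g x * v x + u x * h x\<bar> \<le> M * B + A * N" if x: "x \<in> {0<..<1}" for x
  proof -
    have "\<bar>g x\<bar> \<le> M" "\<bar>h x\<bar> \<le> N" "\<bar>u x\<bar> \<le> A" "\<bar>v x\<bar> \<le> B" using MN AB x by auto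
    hence "\<bar>g x\<bar> * \<bar>v x\<bar> \<le> M * B" "\<bar>u x\<bar> * \<bar>h x\<bar> \<le> A * N" by (auto intro!: mult_mono)
    moreover have "\<bar>g x * v x + u x * h x\<bar> \<le> \<bar>g x\<bar> * \<bar>v x\<bar> + \<bar>u x\<bar> * \<bar>h x\<bar>"
      by (metis abs_mult abs_triangle_ineq)
    ultimately show ?thesis by linarith
  qed
  thus "\<exists>M. \<forall>x\<in>{0<..<1}. \<bar>g x * v x + u x * h x\<bar> \<le> M" by blast
  obtain S T where "finite S" "\<forall>x\<in>{0<..<1} - S. (u has_real_derivative g x) (at x)"
    "finite T" "\<forall>x\<in>{0<..<1} - T. (v has_real_derivative h x) (at x)"
    using assms by (auto simp: def)
  thus "\<exists>S. finite S \<and> (\<forall>x\<in>{0<..<1} - S. ((\<lambda>x. u x * v x) has_real_derivative g x * v x + u x * h x) (at x))"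
    by (intro exI[of _ "S \<union> T"]) (auto intro!: derivative_eq_intros)
qed

lemma bounded_primitiveI_C1:
  assumes "\<And>x. (u has_real_derivative g x) (at x)" "continuous_on UNIV g"
  shows "bounded_primitive u g"
proof -
  have "continuous_on {0..1} g" using assms(2) by (rule continuous_on_subset) simp
  moreover obtain M where "\<forall>x\<in>{0..1}. \<bar>g x\<bar> \<le> M" using continuous_on_Icc_bounded[OF calculation] by blast
  ultimately show ?thesis
    unfolding bounded_primitive_def using assms(1)
    by (intro conjI exI[of _ "{}"] exI[of _ M] set_borel_measurable_continuous_Ioo)
      (auto intro!: continuous_at_imp_continuous_on intro: DERIV_isCont)
qed

text \<open>
  Integrating the derivative of \<open>u \<eta>\<close> over the unit interval gives 0, because \<open>\<eta>\<close> vanishes at both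
  ends.
\<close>
lemma bounded_primitive_has_weak_gradient:
  assumes u: "bounded_primitive u g"
  shows "has_weak_gradient {0<..<1} u g"
proof (rule has_weak_gradient_realI)
  have "continuous_on {0..1} u" using u by (simp add: bounded_primitive_def)
  with continuous_on_Icc_bounded[OF this] have "set_integrable lebesgue {0<..<1} u"
    by (auto intro!: set_integrable_bounded set_borel_measurable_continuous_Ioo)
  moreover have gi: "set_integrable lebesgue {0<..<1} g" using bounded_primitive_integral(1)[OF u] by simp
  ultimately show loc: "in_Lp_loc 1 {0<..<1} u" "in_Lp_loc 1 {0<..<1} g"
    by (auto simp: in_Lp_loc_1_iff elim!: set_integrable_subset dest: lmeasurable_compact fmeasurableD)
  fix \<eta> \<eta>' :: "real \<Rightarrow> real" assume t: "test_function {0<..<1} \<eta>" and D: "\<And>x. (\<eta> has_real_derivative \<eta>' x) (at x)"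
  note td = test_functionD[OF t D]
  have "bounded_primitive (\<lambda>x. u x * \<eta> x) (\<lambda>x. g x * \<eta> x + u x * \<eta>' x)"
    by (intro bounded_primitive_mult u bounded_primitiveI_C1 D td)
  from bounded_primitive_integral(2)[OF this, of 0 1]
  have "(LINT x:{0<..<1}|lebesgue. g x * \<eta> x + u x * \<eta>' x) = u 1 * \<eta> 1 - u 0 * \<eta> 0" by simp
  moreover have "\<eta> 0 = 0" "\<eta> 1 = 0" using td(4) by (auto intro!: td(5))
  moreover have "set_integrable lebesgue {0<..<1} (\<lambda>x. u x * \<eta>' x)"
    by (rule set_integrable_mult_compact_support[OF loc(1) td(3,4,2,6)])
  moreover have "set_integrable lebesgue {0<..<1} (\<lambda>x. g x * \<eta> x)"
    by (rule set_integrable_mult_compact_support[OF loc(2) td(3,4,1,5)])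
  ultimately show "(LINT x:{0<..<1}|lebesgue. u x * \<eta>' x) = - (LINT x:{0<..<1}|lebesgue. g x * \<eta> x)"
    by simp
qed

lemma in_Lp_bounded:
  fixes f :: "real \<Rightarrow> real"
  assumes "set_borel_measurable lebesgue {a<..<b} f" "\<And>x. x \<in> {a<..<b} \<Longrightarrow> \<bar>f x\<bar> \<le> M" "0 \<le> p"
  shows "in_Lp p {a<..<b} f"
  unfolding in_Lp_def
proof
  define F where "F x = indicator {a<..<b} x *\<^sub>R f x" for x
  have [measurable]: "F \<in> borel_measurable lebesgue"
    using assms(1) by (simp add: set_borel_measurable_def F_def[abs_def])
  have "{a<..<b} \<in> sets lebesgue" by simp
  hence "(\<lambda>x. indicator {a<..<b} x * \<bar>F x\<bar> powr p) \<in> borel_measurable lebesgue"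
    by measurable
  moreover have "indicator {a<..<b} x * \<bar>F x\<bar> powr p = indicator {a<..<b} x *\<^sub>R \<bar>f x\<bar> powr p" for x
    by (auto simp: indicator_def F_def)
  ultimately have "set_borel_measurable lebesgue {a<..<b} (\<lambda>x. \<bar>f x\<bar> powr p)"
    by (simp add: set_borel_measurable_def)
  thus "set_integrable lebesgue {a<..<b} (\<lambda>x. norm (f x) powr p)"
    using assms(2,3) by (intro set_integrable_bounded[where M="M powr p"]) (auto intro!: powr_mono2)
qed fact

lemma bounded_primitive_in_Lp:
  assumes "bounded_primitive u g" "0 \<le> p"
  shows "in_Lp p {0<..<1} u" "in_Lp p {0<..<1} g"
proof -
  have c: "continuous_on {0..1} u" using assms by (simp add: bounded_primitive_def)
  obtain A where "\<forall>x\<in>{0..1}. \<bar>u x\<bar> \<le> A" using continuous_on_Icc_bounded[OF c] by auto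
  thus "in_Lp p {0<..<1} u"
    by (intro in_Lp_bounded[where M=A] set_borel_measurable_continuous_Ioo c assms) auto
  show "in_Lp p {0<..<1} g" using assms by (auto simp: bounded_primitive_def intro: in_Lp_bounded)
qed

lemma in_Lp_imp_loc:
  fixes f :: "real \<Rightarrow> real"
  shows "in_Lp p \<Omega> f \<Longrightarrow> in_Lp_loc p \<Omega> f"
  by (rule in_Lp_locI) (auto simp: in_Lp_def elim!: set_integrable_subset dest: lmeasurable_compact fmeasurableD)

lemma bounded_primitive_in_W1p:
  assumes "bounded_primitive u g" "0 \<le> p"
  shows "u \<in> W1p p {0<..<1}" "u \<in> W1p_loc p {0<..<1}"
  using bounded_primitive_in_Lp[OF assms] bounded_primitive_has_weak_gradient[OF assms(1)] in_Lp_imp_loc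
  by (auto simp: W1p_def W1p_loc_def)

lemma Ck_add_cmult:
  fixes f g :: "real \<Rightarrow> real"
  assumes "Ck k f" "Ck k g" shows "Ck k (\<lambda>x. f x + c * g x)"
  using assms
proof (induction k arbitrary: f g)
  case 0 thus ?case by (auto intro!: continuous_on_add continuous_on_mult_left)
next
  case (Suc k)
  obtain f' g' where D: "\<And>x. (f has_real_derivative f' x) (at x)" "\<And>x. (g has_real_derivative g' x) (at x)"
    using Suc.prems by (simp add: real_differentiable_def) metis
  have "Ck k f'" "Ck k g'" using Suc.prems
    by (simp_all add: frechet_derivative_real[OF D(1)] frechet_derivative_real[OF D(2)])
  thus ?case by (intro Ck_Suc_real[OF _ Suc.IH[of f' g']]) (auto intro!: derivative_eq_intros D)
qed

lemma test_function_add_cmult: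
  fixes f g :: "real \<Rightarrow> real"
  assumes f: "test_function \<Omega> f" and g: "test_function \<Omega> g"
  shows "test_function \<Omega> (\<lambda>x. f x + c * g x)"
proof -
  let ?S = "\<lambda>f. closure {x::real. f x \<noteq> (0::real)}"
  have "?S (\<lambda>x. f x + c * g x) \<subseteq> closure ({x. f x \<noteq> 0} \<union> {x. g x \<noteq> 0})"
    by (intro closure_mono) auto
  hence sub: "?S (\<lambda>x. f x + c * g x) \<subseteq> ?S f \<union> ?S g" by (simp add: closure_Un)
  have "compact (?S f \<union> ?S g)" using f g by (auto simp: test_function_def)
  hence "compact ((?S f \<union> ?S g) \<inter> ?S (\<lambda>x. f x + c * g x))" by (rule compact_Int_closed) simp
  hence "compact (?S (\<lambda>x. f x + c * g x))" using sub by (simp only: Int_absorb1)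
  moreover have "?S f \<union> ?S g \<subseteq> \<Omega>" using f g by (simp add: test_function_def)
  moreover have "Ck k (\<lambda>x. f x + c * g x)" for k using f g by (intro Ck_add_cmult) (simp_all add: test_function_def)
  ultimately show ?thesis using sub unfolding test_function_def by blast
qed

text \<open>
  The primitive that vanishes to the left of the support of \<open>\<psi>\<close> equals the total integral of \<open>\<psi>\<close>
  to the right of it, so mean zero is what makes its support compact.
\<close>
lemma test_function_antiderivative:
  fixes \<psi> :: "real \<Rightarrow> real"
  assumes t: "test_function {a<..<b} \<psi>" and "(LINT x:{a<..<b}|lebesgue. \<psi> x) = 0"
  shows "\<exists>\<eta>. test_function {a<..<b} \<eta> \<and> (\<forall>x. (\<eta> has_real_derivative \<psi> x) (at x))"
proof (cases "closure {x. \<psi> x \<noteq> 0} = {}")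
  case True
  hence "\<psi> = (\<lambda>_. 0)" by (auto simp: fun_eq_iff)
  thus ?thesis using t by (intro exI[of _ \<psi>]) auto
next
  case False
  let ?K = "closure {x. \<psi> x \<noteq> 0}"
  have Ck: "Ck k \<psi>" for k using t by (simp add: test_function_def)
  have cont: "continuous_on A \<psi>" for A using Ck[of 0] by (auto elim: continuous_on_subset)
  have K: "compact ?K" "?K \<subseteq> {a<..<b}" using t by (auto simp: test_function_def)
  obtain c where c: "c \<in> ?K" "\<And>x. x \<in> ?K \<Longrightarrow> c \<le> x" using compact_attains_inf[OF K(1) False] by blast
  obtain d where d: "d \<in> ?K" "\<And>x. x \<in> ?K \<Longrightarrow> x \<le> d" using compact_attains_sup[OF K(1) False] by blast
  have acdb: "a < c" "c \<le> d" "d < b" using c d K by auto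
  have z: "\<psi> x = 0" if "x < c \<or> d < x" for x
  proof (rule ccontr)
    assume "\<psi> x \<noteq> 0"
    hence "x \<in> ?K" using closure_subset[of "{x. \<psi> x \<noteq> 0}"] by blast
    thus False using that c(2)[of x] d(2)[of x] by linarith
  qed
  define \<eta> where "\<eta> x = (if x \<in> {a..b} then integral {a..x} \<psi> else 0)" for x
  have int: "\<psi> integrable_on {s..t}" for s t by (intro integrable_continuous_real cont)
  have tot: "integral {a..b} \<psi> = 0"
  proof -
    have "set_integrable lebesgue {a..b} \<psi>" by (rule absolutely_integrable_continuous_real[OF cont])
    hence "set_integrable lebesgue {a<..<b} \<psi>" by (rule set_integrable_subset) auto
    from has_integral_set_lebesgue[OF this] have "(\<psi> has_integral 0) {a..b}"
      using assms(2) by (simp add: has_integral_Icc_iff_Ioo)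
    thus ?thesis by (rule integral_unique)
  qed
  have zero: "\<eta> x = 0" if "x < c \<or> d < x" for x
  proof (cases "x \<in> {a..b}")
    case True
    from that show ?thesis
    proof
      assume "x < c"
      hence "integral {a..x} \<psi> = integral {a..x} (\<lambda>_. 0)" by (intro integral_cong z) auto
      thus ?thesis by (simp add: \<eta>_def)
    next
      assume "d < x"
      hence "integral {x..b} \<psi> = integral {x..b} (\<lambda>_. 0)" by (intro integral_cong z) auto
      moreover have "integral {a..x} \<psi> + integral {x..b} \<psi> = integral {a..b} \<psi>"
        using True by (intro Henstock_Kurzweil_Integration.integral_combine int) auto
      ultimately show ?thesis using tot by (simp add: \<eta>_def)
    qed
  qed (auto simp: \<eta>_def)
  have D: "(\<eta> has_real_derivative \<psi> x) (at x)" for x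
  proof -
    consider "x < c" | "d < x" | "x \<in> {a<..<b}" using acdb by fastforce
    thus ?thesis
    proof cases
      case 1
      have "((\<lambda>_. 0) has_real_derivative 0) (at x)" by simp
      hence "(\<eta> has_real_derivative 0) (at x)"
        by (rule has_field_derivative_transform_within_open[where S="{..<c}"]) (use 1 zero in auto)
      thus ?thesis using z 1 by simp
    next
      case 2
      have "((\<lambda>_. 0) has_real_derivative 0) (at x)" by simp
      hence "(\<eta> has_real_derivative 0) (at x)"
        by (rule has_field_derivative_transform_within_open[where S="{d<..}"]) (use 2 zero in auto)
      thus ?thesis using z 2 by simp
    next
      case 3
      have "((\<lambda>u. integral {a..u} \<psi>) has_real_derivative \<psi> x) (at x within {a..b})"
        by (rule integral_has_real_derivative[OF cont]) (use 3 in auto)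
      hence "((\<lambda>u. integral {a..u} \<psi>) has_real_derivative \<psi> x) (at x)"
        using 3 at_within_interior[of x "{a..b}"] by simp
      thus ?thesis
        by (rule has_field_derivative_transform_within_open[where S="{a<..<b}"]) (use 3 in \<open>auto simp: \<eta>_def\<close>)
    qed
  qed
  have "Ck k \<eta>" for k
  proof (cases k)
    case 0 thus ?thesis using D by (auto intro!: continuous_at_imp_continuous_on intro: DERIV_isCont)
  next
    case (Suc j) thus ?thesis using Ck_Suc_real[OF D Ck] by simp
  qed
  moreover have sub: "closure {x. \<eta> x \<noteq> 0} \<subseteq> {c..d}"

  proof (rule closure_minimal)
    show "{x. \<eta> x \<noteq> 0} \<subseteq> {c..d}"
    proof
      fix x assume "x \<in> {x. \<eta> x \<noteq> 0}"
      hence "\<not> (x < c \<or> d < x)" using zero[of x] by blast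
      thus "x \<in> {c..d}" by auto
    qed
  qed simp
  moreover have "compact (closure {x. \<eta> x \<noteq> 0})"
    using sub by (metis closed_closure closed_Int_compact compact_Icc inf.absorb1)
  moreover have "{c..d} \<subseteq> {a<..<b}" using acdb by auto
  ultimately have "test_function {a<..<b} \<eta>" unfolding test_function_def by blast
  thus ?thesis using D by blast
qed

section \<open>The space \<open>W1p_0\<close> on the unit interval\<close>

lemma nn_set_integral_eq:
  fixes f :: "real \<Rightarrow> real"
  assumes "set_integrable lebesgue A f" "\<And>x. x \<in> A \<Longrightarrow> 0 \<le> f x"
  shows "(\<integral>\<^sup>+x\<in>A. ennreal (f x) \<partial>lebesgue) = ennreal (LINT x:A|lebesgue. f x)"
proof -
  have "(\<integral>\<^sup>+x\<in>A. ennreal (f x) \<partial>lebesgue) = (\<integral>\<^sup>+x. ennreal (indicator A x *\<^sub>R f x) \<partial>lebesgue)"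
    by (intro nn_integral_cong) (auto simp: indicator_def)
  also have "\<dots> = ennreal (LINT x:A|lebesgue. f x)"
    using assms unfolding set_lebesgue_integral_def set_integrable_def
    by (intro nn_integral_eq_integral) (auto simp: indicator_def)
  finally show ?thesis .
qed

lemma abs_set_integral_le:
  fixes f :: "real \<Rightarrow> real"
  assumes f: "set_integrable lebesgue B f" and AB: "A \<in> sets lebesgue" "A \<subseteq> B"
  shows "\<bar>LINT x:A|lebesgue. f x\<bar> \<le> (LINT x:B|lebesgue. \<bar>f x\<bar>)"
  unfolding set_lebesgue_integral_def
proof (rule integral_abs_bound_integral)
  show "integrable lebesgue (\<lambda>x. indicator A x *\<^sub>R f x)"
    using set_integrable_subset[OF f AB] by (simp add: set_integrable_def)
  show "integrable lebesgue (\<lambda>x. indicator B x *\<^sub>R \<bar>f x\<bar>)"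
    using set_integrable_abs[OF f] by (simp add: set_integrable_def)
qed (use AB in \<open>auto simp: indicator_def\<close>)

lemma nn_integral_weak_grad:
  fixes u g :: "real \<Rightarrow> real"
  assumes "has_weak_gradient {a<..<b} u g" "E \<subseteq> {a<..<b}"
  shows "(\<integral>\<^sup>+x\<in>E. ennreal (norm (weak_grad {a<..<b} u x) powr p) \<partial>lebesgue)
       = (\<integral>\<^sup>+x\<in>E. ennreal (\<bar>g x\<bar> powr p) \<partial>lebesgue)"
proof (rule nn_integral_cong_AE)
  show "AE x in lebesgue. ennreal (norm (weak_grad {a<..<b} u x) powr p) * indicator E x
     = ennreal (\<bar>g x\<bar> powr p) * indicator E x"
    using weak_grad_AE_eq[OF assms(1)]
    by eventually_elim (use assms(2) in \<open>auto simp: indicator_def\<close>)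
qed

text \<open>
  As \<open>v\<close> starts at 0, the integral \<open>E\<close> of \<open>\<bar>g\<bar>\<close> bounds \<open>\<bar>v\<bar>\<close>; and \<open>\<bar>g\<bar> powr p\<close> is at most
  \<open>C powr (p - 1) * \<bar>g\<bar>\<close>. For uniformly bounded gradients, convergence in the Sobolev norm therefore
  reduces to \<open>L\<^sup>1\<close> convergence of the gradients.
\<close>
lemma W1p_norm_pow_le:
  assumes v: "bounded_primitive v g" "v 0 = 0" and p: "1 \<le> p"
    and C: "\<And>x. x \<in> {0<..<1} \<Longrightarrow> \<bar>g x\<bar> \<le> C" "0 < C"
  defines "E \<equiv> LINT x:{0<..<1}|lebesgue. \<bar>g x\<bar>"
  shows "W1p_norm_pow p {0<..<1} v \<le> ennreal (E powr p + C powr (p - 1) * E)"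
proof -
  have gi: "set_integrable lebesgue {0<..<1} g" using bounded_primitive_integral(1)[OF v(1), of 0 1] by simp
  have E0: "0 \<le> E" using abs_set_integral_le[OF gi, of "{}"] by (simp add: E_def)
  have vE: "\<bar>v x\<bar> \<le> E" if x: "x \<in> {0<..<1}" for x
  proof -
    have "v x = (LINT t:{0<..<x}|lebesgue. g t)"
      using bounded_primitive_integral(2)[OF v(1), of 0 x] x v(2) by simp
    moreover have "{0<..<x} \<subseteq> {0<..<1}" using x by auto
    ultimately show ?thesis using abs_set_integral_le[OF gi, of "{0<..<x}"] by (simp add: E_def)
  qed
  have "(\<integral>\<^sup>+x\<in>{0<..<1}. ennreal (\<bar>v x\<bar> powr p) \<partial>lebesgue) \<le> (\<integral>\<^sup>+x\<in>{0<..<1::real}. ennreal (E powr p) \<partial>lebesgue)"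
    using vE p by (intro nn_integral_mono) (auto simp: indicator_def intro!: ennreal_leI powr_mono2)
  also have "\<dots> = ennreal (E powr p)" by (simp add: nn_integral_cmult_indicator)
  finally have 1: "(\<integral>\<^sup>+x\<in>{0<..<1}. ennreal (\<bar>v x\<bar> powr p) \<partial>lebesgue) \<le> ennreal (E powr p)" .
  have pw: "\<bar>g x\<bar> powr p \<le> C powr (p - 1) * \<bar>g x\<bar>" if x: "x \<in> {0<..<1}" for x
  proof -
    have "\<bar>g x\<bar> powr p = \<bar>g x\<bar> powr (p - 1) * \<bar>g x\<bar>"
      using powr_add[of "\<bar>g x\<bar>" "p - 1" 1] by simp
    also have "\<dots> \<le> C powr (p - 1) * \<bar>g x\<bar>" using C(1)[OF x] p by (intro mult_right_mono powr_mono2) auto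
    finally show ?thesis .
  qed
  have "(\<integral>\<^sup>+x\<in>{0<..<1}. ennreal (\<bar>g x\<bar> powr p) \<partial>lebesgue)
      \<le> (\<integral>\<^sup>+x\<in>{0<..<1}. ennreal (C powr (p - 1) * \<bar>g x\<bar>) \<partial>lebesgue)"
    using pw by (intro nn_integral_mono) (auto simp: indicator_def intro!: ennreal_leI)
  also have "\<dots> = ennreal (LINT x:{0<..<1}|lebesgue. C powr (p - 1) * \<bar>g x\<bar>)"
    using gi by (intro nn_set_integral_eq) (auto intro: set_integrable_abs)
  also have "\<dots> = ennreal (C powr (p - 1) * E)" by (simp add: E_def)
  finally have 2: "(\<integral>\<^sup>+x\<in>{0<..<1}. ennreal (\<bar>g x\<bar> powr p) \<partial>lebesgue) \<le> ennreal (C powr (p - 1) * E)" .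
  have "W1p_norm_pow p {0<..<1} v \<le> ennreal (E powr p) + ennreal (C powr (p - 1) * E)"
    unfolding W1p_norm_pow_def nn_integral_weak_grad[OF bounded_primitive_has_weak_gradient[OF v(1)] order_refl]
    by (rule add_mono[OF 1 2])
  thus ?thesis using E0 by (simp add: ennreal_plus)
qed

lemma test_function_approximation_L1:
  fixes h :: "real \<Rightarrow> real"
  assumes h: "set_borel_measurable lebesgue {a<..<b} h" and M: "\<And>x. x \<in> {a<..<b} \<Longrightarrow> \<bar>h x\<bar> \<le> M" "0 \<le> M"
  obtains \<psi> where "\<And>n. test_function {a<..<b} (\<psi> n)" "\<And>n x. \<bar>\<psi> n x\<bar> \<le> M + 1"
    "(\<lambda>n. LINT x:{a<..<b}|lebesgue. \<bar>\<psi> n x - h x\<bar>) \<longlonglongrightarrow> 0"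
proof -
  define k where "k x = indicator {a<..<b} x *\<^sub>R h x" for x
  have [measurable]: "k \<in> borel_measurable lebesgue" using h by (simp add: set_borel_measurable_def k_def[abs_def])
  have "\<bar>k x\<bar> \<le> M" for x using M by (auto simp: k_def indicator_def)
  then obtain \<psi> where \<psi>: "\<And>n. test_function {a<..<b} (\<psi> n)" "\<And>n x. \<bar>\<psi> n x\<bar> \<le> M + 1"
    and lim: "AE x in lebesgue. x \<in> {a<..<b} \<longrightarrow> (\<lambda>n. \<psi> n x) \<longlonglongrightarrow> k x"
    using test_function_approximation[of k M a b] by auto
  have [measurable]: "\<psi> n \<in> borel_measurable lebesgue" for n
    using \<psi>(1)[of n] by (intro borel_measurable_lebesgueI borel_measurable_continuous_onI)
      (auto simp: test_function_def dest: spec[of _ 0])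
  have S: "{a<..<b} \<in> sets lebesgue" by simp
  have "(\<lambda>n. LINT x|lebesgue. indicator {a<..<b} x * \<bar>\<psi> n x - k x\<bar>) \<longlonglongrightarrow> (LINT x::real|lebesgue. 0)"
  proof (rule integral_dominated_convergence[where w="\<lambda>x. indicator {a<..<b} x * (2 * M + 1)"])
    have "{a<..<b} \<in> lmeasurable" by simp
    thus "integrable lebesgue (\<lambda>x. indicator {a<..<b} x * (2 * M + 1))"
      by (intro integrable_mult_left) (simp add: fmeasurable_def)
    show "(\<lambda>x. indicator {a<..<b} x * \<bar>\<psi> n x - k x\<bar>) \<in> borel_measurable lebesgue" for n
      using S by measurable
    show "AE x in lebesgue. (\<lambda>n. indicator {a<..<b} x * \<bar>\<psi> n x - k x\<bar>) \<longlonglongrightarrow> 0"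
      using lim
    proof eventually_elim
      case (elim x)
      show ?case
      proof (cases "x \<in> {a<..<b}")
        case True
        hence "(\<lambda>n. \<bar>\<psi> n x - k x\<bar>) \<longlonglongrightarrow> \<bar>k x - k x\<bar>" using elim by (intro tendsto_intros) auto
        thus ?thesis using True by simp
      qed simp
    qed
    show "AE x in lebesgue. norm (indicator {a<..<b} x * \<bar>\<psi> n x - k x\<bar>) \<le> indicator {a<..<b} x * (2 * M + 1)" for n
    proof (rule AE_I2)
      fix x
      have "\<bar>\<psi> n x - k x\<bar> \<le> 2 * M + 1" using \<psi>(2)[of n x] \<open>\<bar>k x\<bar> \<le> M\<close> by linarith
      thus "norm (indicator {a<..<b} x * \<bar>\<psi> n x - k x\<bar>) \<le> indicator {a<..<b} x * (2 * M + 1)"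
        by (auto simp: indicator_def)
    qed
  qed simp
  moreover have "indicator {a<..<b} x * \<bar>\<psi> n x - k x\<bar> = indicator {a<..<b} x *\<^sub>R \<bar>\<psi> n x - h x\<bar>" for n x
    by (auto simp: indicator_def k_def)
  ultimately have "(\<lambda>n. LINT x:{a<..<b}|lebesgue. \<bar>\<psi> n x - h x\<bar>) \<longlonglongrightarrow> 0"
    by (simp add: set_lebesgue_integral_def)
  thus ?thesis using that \<psi> by blast
qed

lemma test_function_set_integrable:
  assumes "test_function \<Omega> (\<psi> :: real \<Rightarrow> real)"
  shows "set_integrable lebesgue {a<..<b} \<psi>"
proof -
  have "Ck 0 \<psi>" using assms by (simp add: test_function_def)
  hence "continuous_on {a..b} \<psi>" by (auto elim: continuous_on_subset)
  hence "set_integrable lebesgue {a..b} \<psi>" by (rule absolutely_integrable_continuous_real)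
  thus ?thesis by (rule set_integrable_subset) auto
qed

lemma test_function_integral_tendsto:
  fixes h :: "real \<Rightarrow> real"
  assumes t: "\<And>n. test_function {a<..<b} (\<psi> n)" and h: "set_integrable lebesgue {a<..<b} h"
    and lim: "(\<lambda>n. LINT x:{a<..<b}|lebesgue. \<bar>\<psi> n x - h x\<bar>) \<longlonglongrightarrow> 0"
  shows "(\<lambda>n. LINT x:{a<..<b}|lebesgue. \<psi> n x) \<longlonglongrightarrow> (LINT x:{a<..<b}|lebesgue. h x)"
proof -
  note i = test_function_set_integrable[OF t, of a b]
  have "(\<lambda>n. (LINT x:{a<..<b}|lebesgue. \<psi> n x) - (LINT x:{a<..<b}|lebesgue. h x)) \<longlonglongrightarrow> 0"
  proof (rule Lim_null_comparison[OF always_eventually[OF allI] lim])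
    fix n
    show "norm ((LINT x:{a<..<b}|lebesgue. \<psi> n x) - (LINT x:{a<..<b}|lebesgue. h x)) \<le> (LINT x:{a<..<b}|lebesgue. \<bar>\<psi> n x - h x\<bar>)"
      using abs_set_integral_le[OF set_integral_diff(1)[OF i h], of "{a<..<b}" n] set_integral_diff(2)[OF i h, of n] by simp
  qed
  thus ?thesis by (simp add: LIM_zero_iff)
qed

text \<open>
  The derivative \<open>h\<close> has mean zero. Test functions \<open>\<psi> n\<close> that converge to \<open>h\<close> in \<open>L\<^sup>1\<close> have means
  \<open>c n\<close> tending to 0, and subtracting \<open>c n\<close> times a fixed test function \<open>\<rho>\<close> of integral 1 restores
  mean zero. The primitives of the corrected functions are test functions that approximate \<open>\<phi>\<close>.
\<close>
lemma bounded_primitive_in_W1p_0: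
  assumes \<phi>: "bounded_primitive \<phi> h" "\<phi> 0 = 0" "\<phi> 1 = 0" and p: "1 \<le> p"
  shows "\<phi> \<in> W1p_0 p {0<..<1}"
proof -
  let ?I = "{0<..<1::real}"
  obtain M0 where M0: "\<forall>x\<in>?I. \<bar>h x\<bar> \<le> M0" using \<phi>(1) by (auto simp: bounded_primitive_def)
  define M where "M = \<bar>M0\<bar>"
  have M: "\<bar>h x\<bar> \<le> M" if "x \<in> ?I" for x using M0 that by (force simp: M_def)
  have hi: "set_integrable lebesgue ?I h" and h0: "(LINT x:?I|lebesgue. h x) = 0"
    using bounded_primitive_integral[OF \<phi>(1), of 0 1] \<phi>(2,3) by auto
  have hm: "set_borel_measurable lebesgue ?I h" using \<phi>(1) by (simp add: bounded_primitive_def)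
  obtain \<psi> where t: "\<And>n. test_function ?I (\<psi> n)" and \<psi>b: "\<And>n x. \<bar>\<psi> n x\<bar> \<le> M + 1"
    and \<psi>l: "(\<lambda>n. LINT x:?I|lebesgue. \<bar>\<psi> n x - h x\<bar>) \<longlonglongrightarrow> 0"
    using test_function_approximation_L1[OF hm M] by (auto simp: M_def)
  obtain \<rho> B where \<rho>: "test_function ?I \<rho>" "(LINT x:?I|lebesgue. \<rho> x) = 1" "\<And>x. \<bar>\<rho> x\<bar> \<le> B"
  proof -
    have 1: "set_integrable lebesgue ?I (\<lambda>_. 1::real)"
      by (rule set_integrable_subset[OF absolutely_integrable_continuous_real[of 0 1]]) auto
    hence "set_borel_measurable lebesgue ?I (\<lambda>_. 1::real)"
      by (simp add: set_integrable_def set_borel_measurable_def borel_measurable_integrable)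
    then obtain \<theta> where \<theta>: "\<And>n. test_function ?I (\<theta> n)" "\<And>n x. \<bar>\<theta> n x\<bar> \<le> 1 + 1"
      "(\<lambda>n. LINT x:?I|lebesgue. \<bar>\<theta> n x - 1\<bar>) \<longlonglongrightarrow> 0"
      using test_function_approximation_L1[of 0 1 "\<lambda>_. 1" 1] by auto
    have "(\<lambda>n. LINT x:?I|lebesgue. \<theta> n x) \<longlonglongrightarrow> 1"
      using test_function_integral_tendsto[OF \<theta>(1) 1 \<theta>(3)] by (simp add: set_lebesgue_integral_def)
    hence "\<forall>\<^sub>F n in sequentially. 0 < (LINT x:?I|lebesgue. \<theta> n x)" by (rule order_tendstoD) simp
    then obtain n where n: "0 < (LINT x:?I|lebesgue. \<theta> n x)" by (auto simp: eventually_sequentially)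
    define c where "c = 1 / (LINT x:?I|lebesgue. \<theta> n x)"
    have z: "test_function ?I (\<lambda>_. 0)"
      using test_function_add_cmult[OF \<theta>(1) \<theta>(1), of n "- 1" n] by simp
    show ?thesis
    proof (rule that[of "\<lambda>x. c * \<theta> n x" "\<bar>c\<bar> * 2"])
      show "test_function ?I (\<lambda>x. c * \<theta> n x)" using test_function_add_cmult[OF z \<theta>(1), of c n] by simp
      show "(LINT x:?I|lebesgue. c * \<theta> n x) = 1" using n by (simp add: c_def)
      show "\<bar>c * \<theta> n x\<bar> \<le> \<bar>c\<bar> * 2" for x using \<theta>(2)[of n x] by (simp add: abs_mult mult_left_mono)
    qed
  qed
  define c where "c n = (LINT x:?I|lebesgue. \<psi> n x)" for n
  have c0: "c \<longlonglongrightarrow> 0" using test_function_integral_tendsto[OF t hi \<psi>l] by (simp add: c_def[abs_def] h0)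
  obtain Mc where Mc: "\<And>n. \<bar>c n\<bar> \<le> Mc"
    using convergent_imp_Bseq[OF convergentI[OF c0]] by (auto simp: Bseq_def)
  define \<zeta> where "\<zeta> n x = \<psi> n x + (- c n) * \<rho> x" for n x
  note \<psi>i = test_function_set_integrable[OF t, of 0 1] and \<rho>i = test_function_set_integrable[OF \<rho>(1), of 0 1]
  have \<zeta>t: "test_function ?I (\<zeta> n)" for n unfolding \<zeta>_def[abs_def] by (intro test_function_add_cmult t \<rho>)
  have "(LINT x:?I|lebesgue. \<zeta> n x) = 0" for n
    using \<psi>i[of n] \<rho>i \<rho>(2) by (simp add: \<zeta>_def c_def)
  then obtain \<eta> where \<eta>: "\<And>n. test_function ?I (\<eta> n)" and D: "\<And>n x. (\<eta> n has_real_derivative \<zeta> n x) (at x)"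
    using test_function_antiderivative[OF \<zeta>t] by metis
  define E where "E n = (LINT x:?I|lebesgue. \<bar>\<zeta> n x - h x\<bar>)" for n
  have \<zeta>i: "set_integrable lebesgue ?I (\<lambda>x. \<zeta> n x - h x)" for n
    by (rule set_integral_diff(1)[OF test_function_set_integrable[OF \<zeta>t] hi])
  have E0: "0 \<le> E n" for n using abs_set_integral_le[OF \<zeta>i, of "{}" n] by (simp add: E_def)
  have E: "E \<longlonglongrightarrow> 0"
  proof (rule Lim_null_comparison)
    have "(\<lambda>n. (LINT x:?I|lebesgue. \<bar>\<psi> n x - h x\<bar>) + \<bar>c n\<bar> * (LINT x:?I|lebesgue. \<bar>\<rho> x\<bar>)) \<longlonglongrightarrow> 0 + \<bar>0\<bar> * (LINT x:?I|lebesgue. \<bar>\<rho> x\<bar>)"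
      by (intro tendsto_intros \<psi>l c0)
    thus "(\<lambda>n. (LINT x:?I|lebesgue. \<bar>\<psi> n x - h x\<bar>) + \<bar>c n\<bar> * (LINT x:?I|lebesgue. \<bar>\<rho> x\<bar>)) \<longlonglongrightarrow> 0" by simp
    show "\<forall>\<^sub>F n in sequentially. norm (E n) \<le> (LINT x:?I|lebesgue. \<bar>\<psi> n x - h x\<bar>) + \<bar>c n\<bar> * (LINT x:?I|lebesgue. \<bar>\<rho> x\<bar>)"
    proof (rule always_eventually, rule allI)
      fix n
      have i1: "set_integrable lebesgue ?I (\<lambda>x. \<bar>\<psi> n x - h x\<bar>)"
        by (rule set_integrable_abs[OF set_integral_diff(1)[OF \<psi>i hi]])
      have i2: "set_integrable lebesgue ?I (\<lambda>x. \<bar>c n\<bar> * \<bar>\<rho> x\<bar>)" using set_integrable_abs[OF \<rho>i] by simp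
      have "E n \<le> (LINT x:?I|lebesgue. \<bar>\<psi> n x - h x\<bar> + \<bar>c n\<bar> * \<bar>\<rho> x\<bar>)"
        unfolding E_def
      proof (rule set_integral_mono[OF set_integrable_abs[OF \<zeta>i] set_integral_add(1)[OF i1 i2]])
        fix x
        have "\<zeta> n x - h x = (\<psi> n x - h x) - c n * \<rho> x" by (simp add: \<zeta>_def)
        thus "\<bar>\<zeta> n x - h x\<bar> \<le> \<bar>\<psi> n x - h x\<bar> + \<bar>c n\<bar> * \<bar>\<rho> x\<bar>"
          using abs_triangle_ineq4[of "\<psi> n x - h x" "c n * \<rho> x"] by (simp add: abs_mult)
      qed
      also have "\<dots> = (LINT x:?I|lebesgue. \<bar>\<psi> n x - h x\<bar>) + \<bar>c n\<bar> * (LINT x:?I|lebesgue. \<bar>\<rho> x\<bar>)"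
        using set_integral_add(2)[OF i1 i2] by simp
      finally show "norm (E n) \<le> (LINT x:?I|lebesgue. \<bar>\<psi> n x - h x\<bar>) + \<bar>c n\<bar> * (LINT x:?I|lebesgue. \<bar>\<rho> x\<bar>)"
        using E0[of n] by simp
    qed
  qed
  define C where "C = (M + 1) + \<bar>Mc\<bar> * \<bar>B\<bar> + M + 1"
  have C: "\<bar>\<zeta> n x - h x\<bar> \<le> C" if x: "x \<in> ?I" for n x
  proof -
    have "\<bar>c n\<bar> * \<bar>\<rho> x\<bar> \<le> \<bar>Mc\<bar> * \<bar>B\<bar>" using Mc[of n] \<rho>(3)[of x] by (intro mult_mono) auto
    hence "\<bar>c n * \<rho> x\<bar> \<le> \<bar>Mc\<bar> * \<bar>B\<bar>" by (simp add: abs_mult)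
    moreover have "\<zeta> n x = \<psi> n x - c n * \<rho> x" by (simp add: \<zeta>_def)
    ultimately show ?thesis using \<psi>b[of n x] M[OF x] unfolding C_def by linarith
  qed
  have "0 \<le> \<bar>Mc\<bar> * \<bar>B\<bar>" by simp
  hence C0: "0 < C" unfolding C_def M_def by linarith
  have le: "W1p_norm_pow p ?I (\<lambda>x. \<eta> n x - \<phi> x) \<le> ennreal (E n powr p + C powr (p - 1) * E n)" for n
    unfolding E_def
  proof (rule W1p_norm_pow_le[OF _ _ p C C0])
    have "continuous_on UNIV (\<zeta> n)" using \<zeta>t[of n] by (auto simp: test_function_def dest: spec[of _ 0])
    thus "bounded_primitive (\<lambda>x. \<eta> n x - \<phi> x) (\<lambda>x. \<zeta> n x - h x)"
      by (intro bounded_primitive_diff \<phi> bounded_primitiveI_C1 D)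
    have "\<eta> n 0 = 0" using test_functionD(4)[OF \<eta> D, of n] by (intro test_functionD(5)[OF \<eta> D]) auto
    thus "\<eta> n 0 - \<phi> 0 = 0" using \<phi> by simp
  qed
  have "(\<lambda>n. E n powr p) \<longlonglongrightarrow> 0"
    using p E0 by (intro tendsto_zero_powrI[OF E tendsto_const]) auto
  moreover have "(\<lambda>n. C powr (p - 1) * E n) \<longlonglongrightarrow> 0" using tendsto_mult_left[OF E] by simp
  ultimately have "(\<lambda>n. E n powr p + C powr (p - 1) * E n) \<longlonglongrightarrow> 0 + 0" by (rule tendsto_add)
  hence "(\<lambda>n. ennreal (E n powr p + C powr (p - 1) * E n)) \<longlonglongrightarrow> ennreal (0 + 0)"
    by (rule tendsto_ennrealI)
  hence lim: "(\<lambda>n. ennreal (E n powr p + C powr (p - 1) * E n)) \<longlonglongrightarrow> 0" by simp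
  have "(\<lambda>n. W1p_norm_pow p ?I (\<lambda>x. \<eta> n x - \<phi> x)) \<longlonglongrightarrow> 0"
    by (rule tendsto_sandwich[OF always_eventually always_eventually tendsto_const lim]) (use le in simp_all)
  moreover have "\<phi> \<in> W1p p ?I" using bounded_primitive_in_W1p(1)[OF \<phi>(1)] p by simp
  ultimately show ?thesis using \<eta> unfolding W1p_0_def by blast
qed

text \<open>
  For every \<open>e > 0\<close> one has \<open>\<bar>t\<bar> \<le> e + e powr (1 - p) * \<bar>t\<bar> powr p\<close>: the first summand suffices when
  \<open>\<bar>t\<bar> \<le> e\<close>, the second one otherwise.
\<close>
lemma Lp_tendsto_zero_imp_L1:
  fixes f :: "nat \<Rightarrow> real \<Rightarrow> real"
  assumes p: "1 < p" and meas: "\<And>n. set_borel_measurable lebesgue {0<..<1} (f n)"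
    and lim: "(\<lambda>n. \<integral>\<^sup>+x\<in>{0<..<1}. ennreal (\<bar>f n x\<bar> powr p) \<partial>lebesgue) \<longlonglongrightarrow> 0"
  shows "(\<lambda>n. \<integral>\<^sup>+x\<in>{0<..<1}. ennreal \<bar>f n x\<bar> \<partial>lebesgue) \<longlonglongrightarrow> 0"
proof (rule order_tendstoI)
  let ?I = "{0<..<1::real}"
  let ?A = "\<lambda>n. \<integral>\<^sup>+x\<in>?I. ennreal (\<bar>f n x\<bar> powr p) \<partial>lebesgue"
  fix a :: ennreal assume "0 < a"
  then obtain b where b: "0 < b" "b < a" using dense by blast
  have "b < top" by (rule order.strict_trans2[OF b(2) top_greatest])
  then obtain r where r: "b = ennreal r" "0 < r" using b by (cases b) (auto simp: ennreal_less_zero_iff)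
  define e where "e = r / 2"
  have e: "0 < e" using r by (simp add: e_def)
  define c where "c = e powr (1 - p)"
  have c: "0 < c" using e by (simp add: c_def)
  have pw: "\<bar>t\<bar> \<le> e + c * \<bar>t\<bar> powr p" for t
  proof (cases "\<bar>t\<bar> \<le> e")
    case False
    hence t: "0 < \<bar>t\<bar>" using e by linarith
    have "\<bar>t\<bar> = \<bar>t\<bar> powr (1 - p) * \<bar>t\<bar> powr p" using t by (simp flip: powr_add)
    also have "\<dots> \<le> c * \<bar>t\<bar> powr p" unfolding c_def
      using False e p by (intro mult_right_mono powr_mono2') auto
    finally show ?thesis using e by linarith
  qed (use c in \<open>auto intro: add_increasing2\<close>)
  have bound: "(\<integral>\<^sup>+x\<in>?I. ennreal \<bar>f n x\<bar> \<partial>lebesgue) \<le> ennreal e + ennreal c * ?A n" for n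
  proof -
    define F where "F x = indicator ?I x *\<^sub>R f n x" for x
    have [measurable]: "F \<in> borel_measurable lebesgue"
      using meas[of n] by (simp add: set_borel_measurable_def F_def[abs_def])
    have P: "(\<lambda>x. ennreal (\<bar>F x\<bar> powr p)) \<in> borel_measurable lebesgue" by measurable
    have I: "?I \<in> sets lebesgue" by simp
    have "(\<integral>\<^sup>+x\<in>?I. ennreal \<bar>f n x\<bar> \<partial>lebesgue) \<le> (\<integral>\<^sup>+x. ennreal e * indicator ?I x + ennreal c * ennreal (\<bar>F x\<bar> powr p) \<partial>lebesgue)"
    proof (rule nn_integral_mono)
      fix x
      show "ennreal \<bar>f n x\<bar> * indicator ?I x \<le> ennreal e * indicator ?I x + ennreal c * ennreal (\<bar>F x\<bar> powr p)"
        using pw[of "f n x"] e c by (cases "x \<in> ?I") (auto simp: F_def simp flip: ennreal_plus ennreal_mult' intro!: ennreal_leI)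
    qed
    also have "\<dots> = (\<integral>\<^sup>+x. ennreal e * indicator ?I x \<partial>lebesgue) + (\<integral>\<^sup>+x. ennreal c * ennreal (\<bar>F x\<bar> powr p) \<partial>lebesgue)"
      by (intro nn_integral_add P borel_measurable_times_ennreal borel_measurable_const borel_measurable_indicator I)
    also have "(\<integral>\<^sup>+x. ennreal e * indicator ?I x \<partial>lebesgue) = ennreal e" by (simp add: nn_integral_cmult_indicator)
    also have "(\<integral>\<^sup>+x. ennreal c * ennreal (\<bar>F x\<bar> powr p) \<partial>lebesgue) = ennreal c * (\<integral>\<^sup>+x. ennreal (\<bar>F x\<bar> powr p) \<partial>lebesgue)"
      by (rule nn_integral_cmult[OF P])
    also have "(\<integral>\<^sup>+x. ennreal (\<bar>F x\<bar> powr p) \<partial>lebesgue) = ?A n"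
      by (intro nn_integral_cong) (auto simp: F_def indicator_def)
    finally show ?thesis .
  qed
  have "(\<lambda>n. ennreal c * ?A n) \<longlonglongrightarrow> ennreal c * 0" by (rule ennreal_tendsto_cmult[OF _ lim]) simp
  hence "\<forall>\<^sub>F n in sequentially. ennreal c * ?A n < ennreal e"
    using e by (intro order_tendstoD(2)[of _ "ennreal c * 0"]) auto
  thus "\<forall>\<^sub>F n in sequentially. (\<integral>\<^sup>+x\<in>?I. ennreal \<bar>f n x\<bar> \<partial>lebesgue) < a"
  proof eventually_elim
    case (elim n)
    have "(\<integral>\<^sup>+x\<in>?I. ennreal \<bar>f n x\<bar> \<partial>lebesgue) \<le> ennreal e + ennreal c * ?A n" by (rule bound)
    also have "\<dots> \<le> ennreal e + ennreal e" using elim by (intro add_left_mono) simp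
    also have "\<dots> = b" using e r by (simp add: e_def flip: ennreal_plus)
    also have "b < a" by fact
    finally show ?case .
  qed
qed simp

lemma set_integrable_if_in_Lp:
  fixes g :: "real \<Rightarrow> real"
  assumes g: "in_Lp p {a<..<b} g" and p: "1 \<le> p"
  shows "set_integrable lebesgue {a<..<b} g"
proof (rule set_integrable_bound)
  have 1: "set_integrable lebesgue {a<..<b} (\<lambda>_. 1::real)"
    by (rule set_integrable_subset[OF absolutely_integrable_continuous_real[of a b]]) auto
  show "set_integrable lebesgue {a<..<b} (\<lambda>x. 1 + \<bar>g x\<bar> powr p)"
    using g by (intro set_integral_add(1)[OF 1]) (simp add: in_Lp_def)
  show "set_borel_measurable lebesgue {a<..<b} g" using g by (simp add: in_Lp_def)
  have "\<bar>t\<bar> \<le> 1 + \<bar>t\<bar> powr p" for t :: real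
  proof (cases "\<bar>t\<bar> \<le> 1")
    case False
    hence "\<bar>t\<bar> powr 1 \<le> \<bar>t\<bar> powr p" using p by (intro powr_mono) auto
    thus ?thesis by simp
  qed (simp add: add_increasing2)
  thus "AE x in lebesgue. x \<in> {a<..<b} \<longrightarrow> norm (g x) \<le> norm (1 + \<bar>g x\<bar> powr p)"
    by (intro AE_I2) (simp add: abs_of_nonneg)
qed

text \<open>
  The gradients of approximating test functions converge in \<open>L\<^sup>1\<close>, so the test functions converge
  uniformly to the primitive \<open>\<Phi>\<close> of the weak gradient. They vanish at both ends of the interval, and
  so does \<open>\<Phi>\<close>.
\<close>
lemma W1p_0_continuous_representative:
  assumes \<phi>: "\<phi> \<in> W1p_0 p {0<..<1::real}" and p: "1 < p"
  obtains g \<Phi> where "has_weak_gradient {0<..<1} \<phi> g" "set_integrable lebesgue {0<..<1} g"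
    "continuous_on {0..1} \<Phi>" "\<Phi> 0 = 0" "\<Phi> 1 = 0"
    "AE x in lebesgue. x \<in> {0<..<1} \<longrightarrow> \<phi> x = \<Phi> x"
    "\<And>a b. 0 \<le> a \<Longrightarrow> a \<le> b \<Longrightarrow> b \<le> 1 \<Longrightarrow> (LINT x:{a<..<b}|lebesgue. g x) = \<Phi> b - \<Phi> a"
proof -
  let ?I = "{0<..<1::real}"
  obtain \<eta> where t: "\<And>k. test_function ?I (\<eta> k)"
    and lim: "(\<lambda>k. W1p_norm_pow p ?I (\<lambda>x. \<eta> k x - \<phi> x)) \<longlonglongrightarrow> 0"
    using \<phi> by (auto simp: W1p_0_def)
  obtain g where wg: "has_weak_gradient ?I \<phi> g" and gp: "in_Lp p ?I g" and \<phi>p: "in_Lp p ?I \<phi>"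
    using \<phi> by (auto simp: W1p_0_def W1p_def)
  have "\<forall>k. \<exists>\<eta>'. \<forall>x. (\<eta> k has_real_derivative \<eta>' x) (at x)" using test_function_differentiable[OF t] by blast
  then obtain \<eta>' where D: "\<And>k x. (\<eta> k has_real_derivative \<eta>' k x) (at x)" by metis
  have bp: "bounded_primitive (\<eta> k) (\<eta>' k)" for k
    by (intro bounded_primitiveI_C1 D test_functionD(2)[OF t D])
  have gi: "set_integrable lebesgue ?I g" using set_integrable_if_in_Lp[OF gp] p by simp
  have \<eta>i: "set_integrable lebesgue ?I (\<eta>' k)" for k using bounded_primitive_integral(1)[OF bp, of 0 1] by simp
  have di: "set_integrable lebesgue ?I (\<lambda>x. \<eta>' k x - g x)" for k by (rule set_integral_diff(1)[OF \<eta>i gi])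
  have wd: "has_weak_gradient ?I (\<lambda>x. \<eta> k x - \<phi> x) (\<lambda>x. \<eta>' k x - g x)" for k
    by (rule has_weak_gradient_diff[OF bounded_primitive_has_weak_gradient[OF bp] wg])
  have pow: "W1p_norm_pow p ?I (\<lambda>x. \<eta> k x - \<phi> x) = (\<integral>\<^sup>+x\<in>?I. ennreal (\<bar>\<eta> k x - \<phi> x\<bar> powr p) \<partial>lebesgue)
      + (\<integral>\<^sup>+x\<in>?I. ennreal (\<bar>\<eta>' k x - g x\<bar> powr p) \<partial>lebesgue)" for k
    unfolding W1p_norm_pow_def nn_integral_weak_grad[OF wd order_refl] ..
  have "(\<lambda>k. \<integral>\<^sup>+x\<in>?I. ennreal (\<bar>\<eta> k x - \<phi> x\<bar> powr p) \<partial>lebesgue) \<longlonglongrightarrow> 0"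
    by (rule tendsto_sandwich[OF always_eventually always_eventually tendsto_const lim]) (simp_all add: pow)
  hence lim1: "(\<lambda>k. \<integral>\<^sup>+x\<in>?I. ennreal \<bar>\<eta> k x - \<phi> x\<bar> \<partial>lebesgue) \<longlonglongrightarrow> 0"
  proof (rule Lp_tendsto_zero_imp_L1[OF p, rotated])
    fix k
    have "(\<lambda>x. indicator ?I x *\<^sub>R \<eta> k x - indicator ?I x *\<^sub>R \<phi> x) \<in> borel_measurable lebesgue"
      using \<phi>p bounded_primitive_in_Lp(1)[OF bp[of k], of p] p
      by (intro borel_measurable_diff) (simp_all add: in_Lp_def set_borel_measurable_def)
    thus "set_borel_measurable lebesgue ?I (\<lambda>x. \<eta> k x - \<phi> x)"
      by (simp add: set_borel_measurable_def right_diff_distrib)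
  qed
  have "(\<lambda>k. \<integral>\<^sup>+x\<in>?I. ennreal (\<bar>\<eta>' k x - g x\<bar> powr p) \<partial>lebesgue) \<longlonglongrightarrow> 0"
    by (rule tendsto_sandwich[OF always_eventually always_eventually tendsto_const lim]) (simp_all add: pow)
  hence "(\<lambda>k. \<integral>\<^sup>+x\<in>?I. ennreal \<bar>\<eta>' k x - g x\<bar> \<partial>lebesgue) \<longlonglongrightarrow> 0"
    by (rule Lp_tendsto_zero_imp_L1[OF p, rotated])
      (use di in \<open>simp add: set_integrable_def set_borel_measurable_def borel_measurable_integrable\<close>)
  moreover define e where "e k = (LINT x:?I|lebesgue. \<bar>\<eta>' k x - g x\<bar>)" for k
  have "(\<integral>\<^sup>+x\<in>?I. ennreal \<bar>\<eta>' k x - g x\<bar> \<partial>lebesgue) = ennreal (e k)" for k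
    unfolding e_def by (rule nn_set_integral_eq[OF set_integrable_abs[OF di]]) simp
  ultimately have lim2: "(\<lambda>k. ennreal (e k)) \<longlonglongrightarrow> 0" by simp
  have e0: "0 \<le> e k" for k using abs_set_integral_le[OF di, of "{}" k] by (simp add: e_def)
  have lim2': "e \<longlonglongrightarrow> 0" using lim2 e0 by (subst (asm) ennreal_0[symmetric], subst (asm) tendsto_ennreal_iff) auto

  define \<Phi> where "\<Phi> x = integral {0..x} g" for x
  have "(g has_integral (LINT x:?I|lebesgue. g x)) ?I" by (rule has_integral_set_lebesgue[OF gi])
  hence gint: "g integrable_on {0..1}" by (auto simp: has_integral_Icc_iff_Ioo[symmetric] integrable_on_def)
  have cont: "continuous_on {0..1} \<Phi>" unfolding \<Phi>_def by (rule indefinite_integral_continuous_1[OF gint])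
  have incr: "(LINT x:{a<..<b}|lebesgue. g x) = \<Phi> b - \<Phi> a" if "0 \<le> a" "a \<le> b" "b \<le> 1" for a b
  proof -
    have "set_integrable lebesgue {a<..<b} g" by (rule set_integrable_subset[OF gi]) (use that in auto)
    from has_integral_set_lebesgue[OF this]
    have "integral {a..b} g = (LINT x:{a<..<b}|lebesgue. g x)"
      by (simp add: has_integral_Icc_iff_Ioo[symmetric] integral_unique)
    moreover have "integral {0..a} g + integral {a..b} g = integral {0..b} g"
      by (intro Henstock_Kurzweil_Integration.integral_combine that integrable_subinterval_real[OF gint]) (use that in auto)
    ultimately show ?thesis by (simp add: \<Phi>_def)
  qed
  have \<Phi>0: "\<Phi> 0 = 0" by (simp add: \<Phi>_def)
  have \<eta>0: "\<eta> k 0 = 0" "\<eta> k 1 = 0" for k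
    using test_functionD(4)[OF t D, of k] by (auto intro!: test_functionD(5)[OF t D])
  have close: "\<bar>\<eta> k x - \<Phi> x\<bar> \<le> e k" if x: "x \<in> {0..1}" for k x
  proof -
    have sub: "{0<..<x} \<subseteq> ?I" using x by auto
    have i: "set_integrable lebesgue {0<..<x} (\<eta>' k)" "set_integrable lebesgue {0<..<x} g"
      using set_integrable_subset[OF \<eta>i _ sub] set_integrable_subset[OF gi _ sub] by auto
    have "\<eta> k x - \<Phi> x = (LINT y:{0<..<x}|lebesgue. \<eta>' k y - g y)"
      using set_integral_diff(2)[OF i] bounded_primitive_integral(2)[OF bp, of 0 x k] incr[of 0 x] x \<eta>0 \<Phi>0 by simp
    thus ?thesis using abs_set_integral_le[OF di _ sub, of k] by (simp add: e_def)
  qed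
  have \<Phi>1: "\<Phi> 1 = 0"
  proof -
    have "\<bar>\<Phi> 1\<bar> \<le> e k" for k using close[of 1 k] \<eta>0 by simp
    hence "\<bar>\<Phi> 1\<bar> \<le> 0" by (intro LIMSEQ_le_const[OF lim2']) auto
    thus ?thesis by simp
  qed
  have ae: "AE x in lebesgue. x \<in> ?I \<longrightarrow> \<phi> x = \<Phi> x"
  proof -
    define F where "F x = indicator ?I x *\<^sub>R \<phi> x - indicator ?I x *\<^sub>R \<Phi> x" for x
    have F [measurable]: "F \<in> borel_measurable lebesgue" unfolding F_def
      using \<phi>p set_borel_measurable_continuous_Ioo[OF cont]
      by (intro borel_measurable_diff) (simp_all add: in_Lp_def set_borel_measurable_def)
    have le: "(\<integral>\<^sup>+x. ennreal \<bar>F x\<bar> \<partial>lebesgue) \<le> (\<integral>\<^sup>+x\<in>?I. ennreal \<bar>\<eta> k x - \<phi> x\<bar> \<partial>lebesgue) + ennreal (e k)" for k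
    proof -
      define H where "H x = indicator ?I x *\<^sub>R \<eta> k x - indicator ?I x *\<^sub>R \<phi> x" for x
      have H [measurable]: "H \<in> borel_measurable lebesgue" unfolding H_def
        using \<phi>p bounded_primitive_in_Lp(1)[OF bp[of k], of p] p
        by (intro borel_measurable_diff) (simp_all add: in_Lp_def set_borel_measurable_def)
      have I: "?I \<in> sets lebesgue" by simp
      have "(\<integral>\<^sup>+x. ennreal \<bar>F x\<bar> \<partial>lebesgue) \<le> (\<integral>\<^sup>+x. ennreal \<bar>H x\<bar> + ennreal (e k) * indicator ?I x \<partial>lebesgue)"
      proof (rule nn_integral_mono)
        fix x
        show "ennreal \<bar>F x\<bar> \<le> ennreal \<bar>H x\<bar> + ennreal (e k) * indicator ?I x"
        proof (cases "x \<in> ?I")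
          case True
          have "\<bar>\<phi> x - \<Phi> x\<bar> \<le> \<bar>\<eta> k x - \<phi> x\<bar> + e k" using close[of x k] True by simp
          thus ?thesis using True e0 by (simp add: F_def H_def flip: ennreal_plus)
        qed (simp add: F_def)
      qed
      also have "\<dots> = (\<integral>\<^sup>+x. ennreal \<bar>H x\<bar> \<partial>lebesgue) + (\<integral>\<^sup>+x. ennreal (e k) * indicator ?I x \<partial>lebesgue)"
        by (intro nn_integral_add measurable_compose[OF _ measurable_ennreal] borel_measurable_abs H
            borel_measurable_times_ennreal borel_measurable_const borel_measurable_indicator I)
      also have "(\<integral>\<^sup>+x. ennreal (e k) * indicator ?I x \<partial>lebesgue) = ennreal (e k)"
        by (simp add: nn_integral_cmult_indicator)
      also have "(\<integral>\<^sup>+x. ennreal \<bar>H x\<bar> \<partial>lebesgue) = (\<integral>\<^sup>+x\<in>?I. ennreal \<bar>\<eta> k x - \<phi> x\<bar> \<partial>lebesgue)"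
        by (intro nn_integral_cong) (auto simp: H_def indicator_def)
      finally show ?thesis .
    qed
    have "(\<integral>\<^sup>+x. ennreal \<bar>F x\<bar> \<partial>lebesgue) \<le> 0 + 0"
      by (rule LIMSEQ_le_const[OF tendsto_add[OF lim1 lim2]]) (use le in auto)
    hence "(\<integral>\<^sup>+x. ennreal \<bar>F x\<bar> \<partial>lebesgue) = 0" by simp
    hence "AE x in lebesgue. ennreal \<bar>F x\<bar> = 0" by (subst (asm) nn_integral_0_iff_AE) auto
    thus ?thesis by eventually_elim (auto simp: F_def indicator_def)
  qed
  show ?thesis by (rule that[OF wg gi cont \<Phi>0 \<Phi>1 ae incr])
qed

section \<open>A criterion for quasisuperminimizers\<close>

text \<open>
  An endpoint that belonged to \<open>U\<close> could be added to the component, against its maximality.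
\<close>
lemma open_component_is_Ioo:
  fixes U :: "real set"
  assumes U: "open U" "U \<subseteq> {l<..<r}" and C: "C \<in> components U"
  obtains a b where "C = {a<..<b}" "a < b" "l \<le> a" "b \<le> r" "a \<notin> U" "b \<notin> U"
proof -
  have oC: "open C" using open_components[OF U(1) C] .
  have sub: "C \<subseteq> U" and ne: "C \<noteq> {}" and con: "connected C"
    using C in_components_subset in_components_nonempty in_components_connected by auto
  have bd: "bdd_below C" "bdd_above C" using sub U(2) by (auto intro!: bdd_belowI[of _ l] bdd_aboveI[of _ r] dest!: subsetD)
  define a b where "a = Inf C" and "b = Sup C"
  have le: "a \<le> x" "x \<le> b" if "x \<in> C" for x
    using that bd by (auto simp: a_def b_def intro: cInf_lower cSup_upper)
  have CI: "C = {a<..<b}"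
  proof (intro equalityI subsetI)
    fix x assume x: "x \<in> C"
    then obtain e where e: "0 < e" "ball x e \<subseteq> C" using oC openE by blast
    have "x - e/2 \<in> C" "x + e/2 \<in> C" using e by (auto intro!: subsetD[OF e(2)] simp: dist_real_def)
    thus "x \<in> {a<..<b}" using le[of "x - e/2"] le[of "x + e/2"] e(1) by auto
  next
    fix x assume x: "x \<in> {a<..<b}"
    obtain c where "c \<in> C" "c < x" using x ne bd cInf_less_iff[OF ne bd(1)] by (auto simp: a_def)
    moreover obtain d where "d \<in> C" "x < d" using x ne bd less_cSup_iff[OF ne bd(2)] by (auto simp: b_def)
    ultimately show "x \<in> C" using connected_contains_Icc[OF con, of c d] by auto
  qed
  have ab: "a < b" using ne CI by auto
  have "a \<notin> U"
  proof
    assume "a \<in> U"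
    hence "{a..<b} \<subseteq> U" using sub CI ab by (auto simp: less_le subset_iff)
    moreover have "(a + b) / 2 \<in> C \<inter> {a..<b}" using ab CI by simp
    ultimately have "{a..<b} \<subseteq> C" by (intro components_maximal[OF C]) auto
    thus False using ab CI by auto
  qed
  moreover have "b \<notin> U"
  proof
    assume "b \<in> U"
    hence "{a<..b} \<subseteq> U" using sub CI ab by (auto simp: less_le subset_iff)
    moreover have "(a + b) / 2 \<in> C \<inter> {a<..b}" using ab CI by simp
    ultimately have "{a<..b} \<subseteq> C" by (intro components_maximal[OF C]) auto
    thus False using ab CI by auto
  qed
  moreover have "l \<le> a" unfolding a_def using sub U(2) ne by (intro cInf_greatest) auto
  moreover have "b \<le> r" unfolding b_def using sub U(2) ne by (intro cSup_least) auto
  ultimately show ?thesis using that CI ab by blast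
qed

lemma nn_integral_open_le_by_components:
  fixes U :: "real set"
  assumes U: "open U" and F: "F \<in> borel_measurable lebesgue" and G: "G \<in> borel_measurable lebesgue"
    and le: "\<And>C. C \<in> components U \<Longrightarrow> (\<integral>\<^sup>+x\<in>C. F x \<partial>lebesgue) \<le> c * (\<integral>\<^sup>+x\<in>C. G x \<partial>lebesgue)"
  shows "(\<integral>\<^sup>+x\<in>U. F x \<partial>lebesgue) \<le> c * (\<integral>\<^sup>+x\<in>U. G x \<partial>lebesgue)"
proof -
  let ?\<C> = "components U"
  have op: "open C" if "C \<in> ?\<C>" for C using open_components[OF U that] .
  have sets: "C \<in> sets lebesgue" if "C \<in> ?\<C>" for C using op[OF that] by simp
  have pw: "pairwise disjnt ?\<C>" using pairwise_disjoint_components[of U] by (simp add: pairwise_def disjnt_def)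
  have ct: "countable ?\<C>" by (rule countable_disjoint_open_subsets[OF op pw])
  have disj: "disjoint_family_on (\<lambda>C. C) ?\<C>" using pairwise_disjoint_components[of U]
    by (auto simp: pairwise_def disjoint_family_on_def)
  have split: "(\<integral>\<^sup>+x\<in>U. H x \<partial>lebesgue) = (\<integral>\<^sup>+C. (\<integral>\<^sup>+x\<in>C. H x \<partial>lebesgue) \<partial>count_space ?\<C>)"
    if H: "H \<in> borel_measurable lebesgue" for H :: "real \<Rightarrow> ennreal"
  proof -
    have "(\<integral>\<^sup>+x\<in>U. H x \<partial>lebesgue) = emeasure (density lebesgue H) (\<Union>((\<lambda>C. C) ` ?\<C>))"
      using U by (subst emeasure_density[OF H]) auto
    also have "\<dots> = (\<integral>\<^sup>+C. emeasure (density lebesgue H) C \<partial>count_space ?\<C>)"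
      by (rule emeasure_UN_countable[OF _ ct disj]) (use sets in simp)
    also have "\<dots> = (\<integral>\<^sup>+C. (\<integral>\<^sup>+x\<in>C. H x \<partial>lebesgue) \<partial>count_space ?\<C>)"
      by (rule nn_integral_cong) (use sets in \<open>simp add: emeasure_density[OF H]\<close>)
    finally show ?thesis .
  qed
  have "(\<integral>\<^sup>+x\<in>U. F x \<partial>lebesgue) \<le> (\<integral>\<^sup>+C. c * (\<integral>\<^sup>+x\<in>C. G x \<partial>lebesgue) \<partial>count_space ?\<C>)"
    unfolding split[OF F] by (rule nn_integral_mono) (use le in simp)
  also have "\<dots> = c * (\<integral>\<^sup>+x\<in>U. G x \<partial>lebesgue)" unfolding split[OF G] by (rule nn_integral_cmult) simp
  finally show ?thesis .
qed

text \<open>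
  The tangent inequality bounds \<open>\<bar>g + h\<bar> powr p\<close> from below by an affine function of \<open>g + h\<close>, whose
  integral does not change when \<open>h\<close> is dropped. The positive part of that affine function is
  integrated because the integrals in the conclusion are extended nonnegative ones.
\<close>
lemma energy_le_on_interval:
  fixes g h :: "real \<Rightarrow> real"
  assumes p: "1 < p" and Q: "0 \<le> Q" and m: "0 < m"
    and gp: "set_integrable lebesgue {a<..<b} (\<lambda>x. \<bar>g x\<bar> powr p)"
    and g: "set_integrable lebesgue {a<..<b} g" and h: "set_integrable lebesgue {a<..<b} h"
    and h0: "(LINT x:{a<..<b}|lebesgue. h x) = 0"
    and le: "(LINT x:{a<..<b}|lebesgue. \<bar>g x\<bar> powr p)
      \<le> Q * (LINT x:{a<..<b}|lebesgue. m powr p * (1 + p * (g x / m - 1)))"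
  shows "(\<integral>\<^sup>+x\<in>{a<..<b}. ennreal (\<bar>g x\<bar> powr p) \<partial>lebesgue)
     \<le> ennreal Q * (\<integral>\<^sup>+x\<in>{a<..<b}. ennreal (\<bar>g x + h x\<bar> powr p) \<partial>lebesgue)"
proof -
  let ?J = "{a<..<b}"
  define f where "f x = m powr p * (1 + p * ((g x + h x) / m - 1))" for x
  define c where "c = m powr p * (p / m)"
  have 1: "set_integrable lebesgue ?J (\<lambda>_. d)" for d :: real
    by (rule set_integrable_subset[OF absolutely_integrable_continuous_real[of a b]]) auto
  have f_eq: "f x = m powr p * (1 + p * (g x / m - 1)) + c * h x" for x
    using m by (simp add: f_def c_def field_simps)
  have l_eq: "m powr p * (1 + p * (g x / m - 1)) = m powr p * (1 - p) + c * g x" for x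
    using m by (simp add: c_def field_simps)
  have li: "set_integrable lebesgue ?J (\<lambda>x. m powr p * (1 + p * (g x / m - 1)))"
    unfolding l_eq by (intro set_integral_add(1) 1 set_integrable_mult_right g)
  have fi: "set_integrable lebesgue ?J f"
    unfolding f_eq[abs_def] by (intro set_integral_add(1) li set_integrable_mult_right h)
  have f_int: "(LINT x:?J|lebesgue. f x) = (LINT x:?J|lebesgue. m powr p * (1 + p * (g x / m - 1)))"
    unfolding f_eq[abs_def] using set_integral_add(2)[OF li set_integrable_mult_right[of c, OF h]] h0 by simp
  have fpi: "set_integrable lebesgue ?J (\<lambda>x. max 0 (f x))"
  proof (rule set_integrable_bound[OF fi])
    have "(\<lambda>x. max 0 (indicator ?J x *\<^sub>R f x)) \<in> borel_measurable lebesgue"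
      using fi by (intro borel_measurable_max) (simp_all add: set_integrable_def borel_measurable_integrable)
    moreover have "max 0 (indicator ?J x *\<^sub>R f x) = indicator ?J x *\<^sub>R max 0 (f x)" for x by (simp add: indicator_def)
    ultimately show "set_borel_measurable lebesgue ?J (\<lambda>x. max 0 (f x))" by (simp add: set_borel_measurable_def)
  qed auto
  have "(\<integral>\<^sup>+x\<in>?J. ennreal (\<bar>g x\<bar> powr p) \<partial>lebesgue) = ennreal (LINT x:?J|lebesgue. \<bar>g x\<bar> powr p)"
    by (rule nn_set_integral_eq[OF gp]) simp
  also have "\<dots> \<le> ennreal (Q * (LINT x:?J|lebesgue. max 0 (f x)))"
  proof (rule ennreal_leI)
    have "(LINT x:?J|lebesgue. f x) \<le> (LINT x:?J|lebesgue. max 0 (f x))"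
      by (rule set_integral_mono[OF fi fpi]) simp
    thus "(LINT x:?J|lebesgue. \<bar>g x\<bar> powr p) \<le> Q * (LINT x:?J|lebesgue. max 0 (f x))"
      using le f_int Q by (smt (verit) mult_left_mono)
  qed
  also have "\<dots> = ennreal Q * ennreal (LINT x:?J|lebesgue. max 0 (f x))" using Q by (simp add: ennreal_mult')
  also have "ennreal (LINT x:?J|lebesgue. max 0 (f x)) = (\<integral>\<^sup>+x\<in>?J. ennreal (max 0 (f x)) \<partial>lebesgue)"
    by (rule nn_set_integral_eq[symmetric, OF fpi]) simp
  also have "\<dots> \<le> (\<integral>\<^sup>+x\<in>?J. ennreal (\<bar>g x + h x\<bar> powr p) \<partial>lebesgue)"
  proof (intro nn_integral_mono mult_right_mono ennreal_leI)
    fix x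
    show "max 0 (f x) \<le> \<bar>g x + h x\<bar> powr p"
      using powr_above_tangent[OF p m, of "g x + h x"] by (simp add: f_def)
  qed simp
  finally show ?thesis by (simp add: mult_left_mono)
qed

text \<open>
  The criterion by which quasisuperminimizers are recognised. The set where the continuous
  representative of a perturbation \<open>\<phi>\<close> does not vanish splits into intervals at whose ends it is zero.
  On each of them the derivative of \<open>\<phi>\<close> has mean zero, and one reference slope \<open>m\<close>, which may vary
  from interval to interval, certifies the energy inequality. For increasing \<open>u\<close> the best choice is
  the mean slope; any other one that satisfies the inequality serves as well.
\<close>
lemma quasisuperminimizerI:
  fixes u g :: "real \<Rightarrow> real"
  assumes u: "bounded_primitive u g" and p: "1 < p" and Q: "0 \<le> Q"
    and tangent: "\<And>a b. 0 \<le> a \<Longrightarrow> a < b \<Longrightarrow> b \<le> 1 \<Longrightarrow>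
       \<exists>m>0. (LINT x:{a<..<b}|lebesgue. \<bar>g x\<bar> powr p)
         \<le> Q * (LINT x:{a<..<b}|lebesgue. m powr p * (1 + p * (g x / m - 1)))"
  shows "quasisuperminimizer p Q {0<..<1} u"
  unfolding quasisuperminimizer_def
proof (intro conjI ballI impI)
  let ?I = "{0<..<1::real}"
  show "u \<in> W1p_loc p ?I" using bounded_primitive_in_W1p(2)[OF u] p by simp
  fix \<phi> assume \<phi>: "\<phi> \<in> W1p_0 p ?I"
  obtain h \<Phi> where h: "has_weak_gradient ?I \<phi> h" "set_integrable lebesgue ?I h"
    and \<Phi>: "continuous_on {0..1} \<Phi>" "\<Phi> 0 = 0" "\<Phi> 1 = 0"
    and ae: "AE x in lebesgue. x \<in> ?I \<longrightarrow> \<phi> x = \<Phi> x"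
    and incr: "\<And>a b. 0 \<le> a \<Longrightarrow> a \<le> b \<Longrightarrow> b \<le> 1 \<Longrightarrow> (LINT x:{a<..<b}|lebesgue. h x) = \<Phi> b - \<Phi> a"
    using W1p_0_continuous_representative[OF \<phi> p] by blast
  let ?E = "{x \<in> ?I. \<phi> x \<noteq> 0}"
  define U where "U = {x \<in> ?I. \<Phi> x \<noteq> 0}"
  have oU: "open U"
  proof -
    have "continuous_on ?I \<Phi>" using \<Phi>(1) by (rule continuous_on_subset) auto
    hence "open (?I \<inter> \<Phi> -` (- {0}))" by (rule continuous_open_preimage) auto
    moreover have "U = ?I \<inter> \<Phi> -` (- {0})" by (auto simp: U_def)
    ultimately show ?thesis by simp
  qed
  have UI: "U \<subseteq> ?I" by (auto simp: U_def)
  have EU: "(\<integral>\<^sup>+x\<in>?E. H x \<partial>lebesgue) = (\<integral>\<^sup>+x\<in>U. H x \<partial>lebesgue)" for H :: "real \<Rightarrow> ennreal"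
    by (rule nn_integral_cong_AE) (use ae in eventually_elim, auto simp: U_def indicator_def)
  define F where "F x = ennreal (\<bar>indicator ?I x *\<^sub>R g x\<bar> powr p)" for x
  define G where "G x = ennreal (\<bar>indicator ?I x *\<^sub>R g x + indicator ?I x *\<^sub>R h x\<bar> powr p)" for x
  have g_meas: "(\<lambda>x. indicator ?I x *\<^sub>R g x) \<in> borel_measurable lebesgue"
    using u by (simp add: bounded_primitive_def set_borel_measurable_def)
  have h_meas: "(\<lambda>x. indicator ?I x *\<^sub>R h x) \<in> borel_measurable lebesgue"
    using h(2) unfolding set_integrable_def by (rule borel_measurable_integrable)
  have FG: "F \<in> borel_measurable lebesgue" "G \<in> borel_measurable lebesgue"
    unfolding F_def G_def
    by (intro measurable_compose[OF _ measurable_ennreal] powr_real_measurable borel_measurable_abs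
        borel_measurable_add g_meas h_meas borel_measurable_const)+
  have gp: "set_integrable lebesgue ?I (\<lambda>x. \<bar>g x\<bar> powr p)"
    using bounded_primitive_in_Lp(2)[OF u, of p] p by (simp add: in_Lp_def)
  have le: "(\<integral>\<^sup>+x\<in>C. F x \<partial>lebesgue) \<le> ennreal Q * (\<integral>\<^sup>+x\<in>C. G x \<partial>lebesgue)" if C: "C \<in> components U" for C
  proof -
    obtain a b where C: "C = {a<..<b}" and ab: "a < b" "0 \<le> a" "b \<le> 1" "a \<notin> U" "b \<notin> U"
      using open_component_is_Ioo[OF oU UI C] .
    have sub: "C \<subseteq> ?I" using C ab by auto
    have z: "\<Phi> a = 0" "\<Phi> b = 0" using ab \<Phi> by (auto simp: U_def less_le)
    obtain m where m: "0 < m" "(LINT x:{a<..<b}|lebesgue. \<bar>g x\<bar> powr p)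
         \<le> Q * (LINT x:{a<..<b}|lebesgue. m powr p * (1 + p * (g x / m - 1)))" using tangent[of a b] ab by auto
    have "(\<integral>\<^sup>+x\<in>C. F x \<partial>lebesgue) = (\<integral>\<^sup>+x\<in>C. ennreal (\<bar>g x\<bar> powr p) \<partial>lebesgue)"
      by (intro nn_integral_cong) (use sub in \<open>auto simp: F_def indicator_def\<close>)
    also have "\<dots> \<le> ennreal Q * (\<integral>\<^sup>+x\<in>C. ennreal (\<bar>g x + h x\<bar> powr p) \<partial>lebesgue)"
      unfolding C
    proof (rule energy_le_on_interval[OF p Q m(1) _ _ _ _ m(2)])
      show "set_integrable lebesgue {a<..<b} (\<lambda>x. \<bar>g x\<bar> powr p)" "set_integrable lebesgue {a<..<b} h"
        using gp h(2) sub by (auto simp: C elim!: set_integrable_subset)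
      show "set_integrable lebesgue {a<..<b} g" using bounded_primitive_integral(1)[OF u] ab by simp
      show "(LINT x:{a<..<b}|lebesgue. h x) = 0" using incr[of a b] ab z by simp
    qed
    also have "(\<integral>\<^sup>+x\<in>C. ennreal (\<bar>g x + h x\<bar> powr p) \<partial>lebesgue) = (\<integral>\<^sup>+x\<in>C. G x \<partial>lebesgue)"
      by (intro nn_integral_cong) (use sub in \<open>auto simp: G_def indicator_def\<close>)
    finally show ?thesis .
  qed
  have "(\<integral>\<^sup>+x\<in>?E. ennreal (norm (weak_grad ?I u x) powr p) \<partial>lebesgue) = (\<integral>\<^sup>+x\<in>?E. ennreal (\<bar>g x\<bar> powr p) \<partial>lebesgue)"
    by (rule nn_integral_weak_grad[OF bounded_primitive_has_weak_gradient[OF u]]) auto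
  also have "\<dots> = (\<integral>\<^sup>+x\<in>U. ennreal (\<bar>g x\<bar> powr p) \<partial>lebesgue)" by (rule EU)
  also have "\<dots> = (\<integral>\<^sup>+x\<in>U. F x \<partial>lebesgue)"
    by (intro nn_integral_cong) (use UI in \<open>auto simp: F_def indicator_def\<close>)
  also have "\<dots> \<le> ennreal Q * (\<integral>\<^sup>+x\<in>U. G x \<partial>lebesgue)"
    by (rule nn_integral_open_le_by_components[OF oU FG le])
  also have "(\<integral>\<^sup>+x\<in>U. G x \<partial>lebesgue) = (\<integral>\<^sup>+x\<in>U. ennreal (\<bar>g x + h x\<bar> powr p) \<partial>lebesgue)"
    by (intro nn_integral_cong) (use UI in \<open>auto simp: G_def indicator_def\<close>)
  also have "\<dots> = (\<integral>\<^sup>+x\<in>?E. ennreal (\<bar>g x + h x\<bar> powr p) \<partial>lebesgue)" by (rule EU[symmetric])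
  also have "\<dots> = (\<integral>\<^sup>+x\<in>?E. ennreal (norm (weak_grad ?I (\<lambda>y. u y + \<phi> y) x) powr p) \<partial>lebesgue)"
    by (rule nn_integral_weak_grad[symmetric, OF has_weak_gradient_add[OF bounded_primitive_has_weak_gradient[OF u] h(1)]]) auto
  finally show "(\<integral>\<^sup>+x\<in>?E. ennreal (norm (weak_grad ?I u x) powr p) \<partial>lebesgue)
     \<le> ennreal Q * (\<integral>\<^sup>+x\<in>?E. ennreal (norm (weak_grad ?I (\<lambda>y. u y + \<phi> y) x) powr p) \<partial>lebesgue)" .
qed

section \<open>Power functions\<close>

lemma set_integral_affine:
  assumes u: "bounded_primitive u g" and ab: "0 \<le> a" "a \<le> b" "b \<le> 1"
  shows "(LINT x:{a<..<b}|lebesgue. A + c * g x) = A * (b - a) + c * (u b - u a)"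
proof -
  have "bounded_primitive (\<lambda>x. A * x) (\<lambda>_. A)"
    by (rule bounded_primitiveI_C1) (auto intro!: derivative_eq_intros continuous_intros)
  note const = bounded_primitive_integral[OF this ab]
  show ?thesis
    using set_integral_add(2)[OF const(1) set_integrable_mult_right[of c, OF bounded_primitive_integral(1)[OF u ab]]]
      const(2) bounded_primitive_integral(2)[OF u ab] by (simp add: right_diff_distrib)
qed

lemma bounded_primitive_power:
  fixes d s :: real
  assumes "0 < d" "0 < s"
  shows "bounded_primitive (\<lambda>x. x * (x / d) powr s) (\<lambda>x. (1 + s) * (x / d) powr s)"
  unfolding bounded_primitive_def
proof (intro conjI)
  have c: "continuous_on {0..1} (\<lambda>x. (x / d) powr s)"
    by (intro continuous_on_powr' continuous_intros) (use assms in auto)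
  show "continuous_on {0..1} (\<lambda>x. x * (x / d) powr s)" by (intro continuous_intros c)
  show "set_borel_measurable lebesgue {0<..<1} (\<lambda>x. (1 + s) * (x / d) powr s)"
    by (intro set_borel_measurable_continuous_Ioo continuous_intros c)
  have "\<bar>(1 + s) * (x / d) powr s\<bar> \<le> (1 + s) * (1 / d) powr s" if "x \<in> {0<..<1}" for x
    using that assms by (auto simp: abs_mult intro!: mult_left_mono powr_mono2 divide_right_mono)
  thus "\<exists>M. \<forall>x\<in>{0<..<1}. \<bar>(1 + s) * (x / d) powr s\<bar> \<le> M" by blast
  have "((\<lambda>x. x * (x / d) powr s) has_real_derivative (1 + s) * (x / d) powr s) (at x)" if x: "0 < x" for x
  proof -
    have "((\<lambda>x. x * (x / d) powr s) has_real_derivative (x / d) powr s + x * (s * (x / d) powr (s - 1) * (1 / d))) (at x)"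
      using x assms by (auto intro!: derivative_eq_intros)
    also have "x * (s * (x / d) powr (s - 1) * (1 / d)) = s * ((x / d) powr (s - 1) * (x / d))" by simp
    also have "(x / d) powr (s - 1) * (x / d) = (x / d) powr s"
      using x assms powr_add[of "x / d" "s - 1" 1] by simp
    finally show ?thesis by (simp add: distrib_right)
  qed
  thus "\<exists>S. finite S \<and> (\<forall>x\<in>{0<..<1} - S. ((\<lambda>x. x * (x / d) powr s) has_real_derivative (1 + s) * (x / d) powr s) (at x))"
    by (intro exI[of _ "{}"]) auto
qed

text \<open>
  With the largest slope \<open>m = g b\<close> of the interval as reference slope, the energy is at most
  \<open>m powr p * (b - a)\<close>, while the mean of \<open>g / m\<close> is at least \<open>1 / (1 + \<delta>)\<close>, so that the affine lower
  bound has mean at least \<open>m powr p * (1 - p * \<delta>)\<close>. The value of \<open>\<delta>\<close> is chosen to make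
  \<open>1 - p * \<delta> = 1 / Q\<close>.
\<close>
lemma quasisuperminimizer_power:
  fixes p Q d :: real
  assumes p: "1 < p" and Q: "1 < Q" and d: "0 < d"
  defines "\<delta> \<equiv> (1 - 1 / Q) / p"
  shows "quasisuperminimizer p Q {0<..<1} (\<lambda>x. x * (x / d) powr \<delta>)"
proof (rule quasisuperminimizerI[OF bounded_primitive_power p])
  have \<delta>: "0 < \<delta>" using p Q by (simp add: \<delta>_def)
  show "0 < d" "0 < \<delta>" "0 \<le> Q" using d \<delta> Q by auto
  let ?u = "\<lambda>x. x * (x / d) powr \<delta>" and ?g = "\<lambda>x. (1 + \<delta>) * (x / d) powr \<delta>"
  note bp = bounded_primitive_power[OF d \<delta>]
  fix a b :: real assume ab: "0 \<le> a" "a < b" "b \<le> 1"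
  define m where "m = ?g b"
  have m: "0 < m" using \<delta> ab d by (simp add: m_def)
  have gm: "\<bar>?g x\<bar> \<le> m" if "x \<in> {a<..<b}" for x
    using that ab d \<delta> by (auto simp: m_def abs_mult intro!: mult_left_mono powr_mono2 divide_right_mono)
  have gp: "set_integrable lebesgue {a<..<b} (\<lambda>x. \<bar>?g x\<bar> powr p)"
  proof -
    have "set_integrable lebesgue {0<..<1} (\<lambda>x. \<bar>?g x\<bar> powr p)"
      using bounded_primitive_in_Lp(2)[OF bp, of p] p by (simp add: in_Lp_def)
    thus ?thesis by (rule set_integrable_subset) (use ab in auto)
  qed
  have one: "bounded_primitive (\<lambda>x. m powr p * x) (\<lambda>_. m powr p)"
    by (rule bounded_primitiveI_C1) (auto intro!: derivative_eq_intros continuous_intros)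
  note const = bounded_primitive_integral[OF one ab(1) less_imp_le[OF ab(2)] ab(3)]
  have "(LINT x:{a<..<b}|lebesgue. \<bar>?g x\<bar> powr p) \<le> (LINT x:{a<..<b}|lebesgue. m powr p)"
    by (rule set_integral_mono[OF gp const(1)]) (use gm p in \<open>auto intro!: powr_mono2\<close>)
  also have "\<dots> = m powr p * (b - a)" using const(2) by (simp add: right_diff_distrib)
  also have "\<dots> \<le> Q * (LINT x:{a<..<b}|lebesgue. m powr p * (1 + p * (?g x / m - 1)))"
  proof -
    have "(LINT x:{a<..<b}|lebesgue. m powr p * (1 + p * (?g x / m - 1)))
        = (LINT x:{a<..<b}|lebesgue. m powr p * (1 - p) + (m powr p * p / m) * ?g x)"
      by (simp add: field_simps)
    also have "\<dots> = m powr p * (1 - p) * (b - a) + (m powr p * p / m) * (?u b - ?u a)"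
      by (rule set_integral_affine[OF bp]) (use ab in auto)
    also have "\<dots> = m powr p * ((1 - p) * (b - a) + p * ((?u b - ?u a) / m))"
      by (simp add: distrib_left)
    finally have int: "(LINT x:{a<..<b}|lebesgue. m powr p * (1 + p * (?g x / m - 1)))
        = m powr p * ((1 - p) * (b - a) + p * ((?u b - ?u a) / m))" .
    have "(b - a) * (b / d) powr \<delta> \<le> ?u b - ?u a"
    proof -
      have "a * (a / d) powr \<delta> \<le> a * (b / d) powr \<delta>"
        using ab d \<delta> by (intro mult_left_mono powr_mono2 divide_right_mono) auto
      thus ?thesis by (simp add: algebra_simps)
    qed
    hence "(b - a) * (b / d) powr \<delta> / m \<le> (?u b - ?u a) / m" using m by (intro divide_right_mono) auto
    moreover have "(b - a) * (b / d) powr \<delta> / m = (b - a) / (1 + \<delta>)"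
      using ab d by (simp add: m_def)
    moreover have "(b - a) * (1 - \<delta>) \<le> (b - a) / (1 + \<delta>)"
    proof -
      have "(1 - \<delta>) * (1 + \<delta>) \<le> 1" by (simp add: algebra_simps)
      hence "1 - \<delta> \<le> 1 / (1 + \<delta>)" using \<delta> by (simp add: field_simps)
      thus ?thesis using ab mult_left_mono[of "1 - \<delta>" "1 / (1 + \<delta>)" "b - a"] by simp
    qed
    ultimately have "p * ((b - a) * (1 - \<delta>)) \<le> p * ((?u b - ?u a) / m)" using p by (intro mult_left_mono) auto
    moreover have "(1 - p) * (b - a) + p * ((b - a) * (1 - \<delta>)) = (b - a) * (1 - p * \<delta>)" by (simp add: algebra_simps)
    moreover have "1 - p * \<delta> = 1 / Q" using p by (simp add: \<delta>_def)
    ultimately have "(b - a) / Q \<le> (1 - p) * (b - a) + p * ((?u b - ?u a) / m)" by simp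
    hence "m powr p * ((b - a) / Q) \<le> m powr p * ((1 - p) * (b - a) + p * ((?u b - ?u a) / m))"
      by (rule mult_left_mono) simp
    hence "Q * (m powr p * ((b - a) / Q)) \<le> Q * (m powr p * ((1 - p) * (b - a) + p * ((?u b - ?u a) / m)))"
      by (rule mult_left_mono) (use Q in simp)
    moreover have "Q * (m powr p * ((b - a) / Q)) = m powr p * (b - a)" using Q by simp
    ultimately show ?thesis unfolding int by linarith
  qed
  finally show "\<exists>m>0. (LINT x:{a<..<b}|lebesgue. \<bar>?g x\<bar> powr p)
    \<le> Q * (LINT x:{a<..<b}|lebesgue. m powr p * (1 + p * (?g x / m - 1)))" using m by blast
qed

section \<open>Functions with two slopes and the minimum\<close>

text \<open>
  The line \<open>Q * (1 + p * (x - 1))\<close> is \<open>Q\<close> times the tangent at 1 of the \<open>p\<close>-th power. It lies above the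
  graph at 1 because \<open>Q > 1\<close>, and below it at 0 and far to the right because \<open>p > 1\<close>; so it meets the
  graph on both sides of 1.
\<close>
lemma tangent_chord_slopes:
  fixes p Q :: real
  assumes p: "1 < p" and Q: "1 < Q"
  obtains \<alpha> \<beta> where "0 < \<alpha>" "\<alpha> < 1" "1 < \<beta>" "\<alpha> powr p = Q * (1 + p * (\<alpha> - 1))" "\<beta> powr p = Q * (1 + p * (\<beta> - 1))"
proof -
  define F where "F x = x powr p - Q * (1 + p * (x - 1))" for x
  have cont: "continuous_on {a..b} F" if "0 \<le> a" for a b unfolding F_def
    by (intro continuous_intros continuous_on_powr') (use that p in auto)
  have F0: "0 < F 0" using p Q by (simp add: F_def algebra_simps)
  have F1: "F 1 < 0" using Q by (simp add: F_def)
  obtain \<alpha> where \<alpha>: "0 \<le> \<alpha>" "\<alpha> \<le> 1" "F \<alpha> = 0"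
    using IVT2'[of F 1 0 0] cont[of 0 1] F0 F1 by auto
  define X where "X = (Q * p) powr (1 / (p - 1))"
  have Qp: "1 < Q * p" using p Q by (simp add: less_1_mult)
  have X: "1 < X" using Qp p by (simp add: X_def)
  have "X powr p = X powr (p - 1) * X" using powr_add[of X "p - 1" 1] X by simp
  also have "X powr (p - 1) = Q * p" using Qp p by (simp add: X_def powr_powr)
  finally have "0 < F X" using p Q by (simp add: F_def algebra_simps)
  then obtain \<beta> where \<beta>: "1 \<le> \<beta>" "\<beta> \<le> X" "F \<beta> = 0"
    using IVT'[of F 1 0 X] cont[of 1 X] F1 X by auto
  have "\<alpha> \<noteq> 0" "\<alpha> \<noteq> 1" "\<beta> \<noteq> 1" using \<alpha> \<beta> F0 F1 by auto
  thus ?thesis using that[of \<alpha> \<beta>] \<alpha> \<beta> by (auto simp: F_def)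
qed

lemma bounded_primitive_max_affine:
  fixes \<alpha> \<beta> d :: real
  assumes "\<alpha> < \<beta>" and d: "\<alpha> * d = 1 - \<beta> * (1 - d)"
  shows "bounded_primitive (\<lambda>x. max (\<alpha> * x) (1 - \<beta> * (1 - x))) (\<lambda>x. if x < d then \<alpha> else \<beta>)"
  unfolding bounded_primitive_def
proof (intro conjI)
  show "continuous_on {0..1} (\<lambda>x. max (\<alpha> * x) (1 - \<beta> * (1 - x)))" by (intro continuous_intros)
  have "(\<lambda>x. if x < d then \<alpha> else \<beta>) \<in> borel_measurable borel" by measurable
  hence "(\<lambda>x. indicator {0<..<1} x *\<^sub>R (if x < d then \<alpha> else \<beta>)) \<in> borel_measurable borel" by measurable
  thus "set_borel_measurable lebesgue {0<..<1} (\<lambda>x. if x < d then \<alpha> else \<beta>)"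
    unfolding set_borel_measurable_def by (rule borel_measurable_lebesgueI)
  show "\<exists>M. \<forall>x\<in>{0<..<1}. \<bar>if x < d then \<alpha> else \<beta>\<bar> \<le> M" by (intro exI[of _ "\<bar>\<alpha>\<bar> + \<bar>\<beta>\<bar>"]) auto
  have diff: "\<alpha> * x - (1 - \<beta> * (1 - x)) = (\<beta> - \<alpha>) * (d - x)" for x
    using d by (simp add: algebra_simps)
  have l: "max (\<alpha> * x) (1 - \<beta> * (1 - x)) = \<alpha> * x" if "x < d" for x
  proof (rule max_absorb1)
    have "0 \<le> (\<beta> - \<alpha>) * (d - x)" using that assms(1) by simp
    thus "1 - \<beta> * (1 - x) \<le> \<alpha> * x" using diff[of x] by linarith
  qed
  have r: "max (\<alpha> * x) (1 - \<beta> * (1 - x)) = 1 - \<beta> * (1 - x)" if "d < x" for x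
  proof (rule max_absorb2)
    have "(\<beta> - \<alpha>) * (d - x) \<le> 0" using that assms(1) by (simp add: mult_le_0_iff)
    thus "\<alpha> * x \<le> 1 - \<beta> * (1 - x)" using diff[of x] by linarith
  qed
  have "((\<lambda>x. max (\<alpha> * x) (1 - \<beta> * (1 - x))) has_real_derivative (if x < d then \<alpha> else \<beta>)) (at x)" if x: "x \<noteq> d" for x
  proof (cases "x < d")
    case True
    have "((\<lambda>x. \<alpha> * x) has_real_derivative \<alpha>) (at x)" by (auto intro!: derivative_eq_intros)
    hence "((\<lambda>x. max (\<alpha> * x) (1 - \<beta> * (1 - x))) has_real_derivative \<alpha>) (at x)"
      by (rule has_field_derivative_transform_within_open[where S="{..<d}"]) (use True l in auto)
    thus ?thesis using True by simp
  next
    case False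
    have "((\<lambda>x. 1 - \<beta> * (1 - x)) has_real_derivative \<beta>) (at x)" by (auto intro!: derivative_eq_intros)
    hence "((\<lambda>x. max (\<alpha> * x) (1 - \<beta> * (1 - x))) has_real_derivative \<beta>) (at x)"
      by (rule has_field_derivative_transform_within_open[where S="{d<..}"]) (use False x r in auto)
    thus ?thesis using False by simp
  qed
  thus "\<exists>S. finite S \<and> (\<forall>x\<in>{0<..<1} - S. ((\<lambda>x. max (\<alpha> * x) (1 - \<beta> * (1 - x))) has_real_derivative (if x < d then \<alpha> else \<beta>)) (at x))"
    by (intro exI[of _ "{d}"]) auto
qed

text \<open>
  Here \<open>d\<close> is the kink of \<open>u2\<close>, placed so that \<open>u2\<close> rises from 0 to 1, and \<open>u1\<close> crosses \<open>u2\<close> at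
  \<open>y < d\<close>. The functions \<open>w\<close> and \<open>g\<close> are the minimum and its derivative, and \<open>(c - 1) * \<alpha> powr p * y\<close>
  is the energy that the minimum has in excess of \<open>u2\<close>.
\<close>
theorem theorem1p3:
  fixes p Q1 Q2 :: real
  assumes "1 < p" and "1 < Q1" and "Q1 \<le> Q2"
  shows "\<exists>u1 u2 :: real \<Rightarrow> real.
    quasisuperminimizer p Q1 {0<..<1} u1 \<and>
    quasisuperminimizer p Q2 {0<..<1} u2 \<and>
    \<not> quasisuperminimizer p Q2 {0<..<1} (\<lambda>x. min (u1 x) (u2 x))"
proof -
  let ?I = "{0<..<1::real}"
  note p = \<open>1 < p\<close>
  have Q2: "1 < Q2" using assms by simp
  obtain \<alpha> \<beta> where \<alpha>: "0 < \<alpha>" "\<alpha> < 1" "\<alpha> powr p = Q2 * (1 + p * (\<alpha> - 1))"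
    and \<beta>: "1 < \<beta>" "\<beta> powr p = Q2 * (1 + p * (\<beta> - 1))"
    using tangent_chord_slopes[OF p Q2] by metis
  define d where "d = (\<beta> - 1) / (\<beta> - \<alpha>)"
  have d: "0 < d" "d < 1" using \<alpha> \<beta> by (auto simp: d_def)
  have "d * (\<beta> - \<alpha>) = \<beta> - 1" using \<alpha> \<beta> by (simp add: d_def)
  hence kink: "\<alpha> * d = 1 - \<beta> * (1 - d)" by (simp add: algebra_simps)
  define \<delta> where "\<delta> = (1 - 1 / Q1) / p"
  have \<delta>: "0 < \<delta>" using assms by (simp add: \<delta>_def)
  define y where "y = d * \<alpha> powr (1 / \<delta>)"
  have y_d: "(y / d) powr \<delta> = \<alpha>" using d \<delta> \<alpha> by (simp add: y_def powr_powr)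
  have "\<alpha> powr (1 / \<delta>) < 1" using \<alpha> \<delta> powr_less_mono2[of "1 / \<delta>" \<alpha> 1] by simp
  hence y: "0 < y" "y < d" using d \<alpha> by (simp_all add: y_def)
  define u1 where "u1 x = x * (x / d) powr \<delta>" for x
  define u2 where "u2 x = max (\<alpha> * x) (1 - \<beta> * (1 - x))" for x
  define g1 where "g1 x = (1 + \<delta>) * (x / d) powr \<delta>" for x
  define g2 where "g2 x = (if x < d then \<alpha> else \<beta>)" for x
  have b1: "bounded_primitive u1 g1" unfolding u1_def[abs_def] g1_def[abs_def]
    by (rule bounded_primitive_power[OF d(1) \<delta>])
  have b2: "bounded_primitive u2 g2" unfolding u2_def[abs_def] g2_def[abs_def]
    by (rule bounded_primitive_max_affine[OF _ kink]) (use \<alpha> \<beta> in simp)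
  have q1: "quasisuperminimizer p Q1 ?I u1" unfolding u1_def[abs_def] \<delta>_def
    by (rule quasisuperminimizer_power) (use assms d in auto)
  have g2p: "\<bar>g2 x\<bar> powr p = Q2 * (1 + p * (g2 x - 1))" for x
    using \<alpha> \<beta> by (simp add: g2_def)
  have q2: "quasisuperminimizer p Q2 ?I u2"
  proof (rule quasisuperminimizerI[OF b2 p])
    show "0 \<le> Q2" using Q2 by simp
    fix a b :: real
    show "\<exists>m>0. (LINT x:{a<..<b}|lebesgue. \<bar>g2 x\<bar> powr p) \<le> Q2 * (LINT x:{a<..<b}|lebesgue. m powr p * (1 + p * (g2 x / m - 1)))"
      by (intro exI[of _ 1]) (simp add: g2p)
  qed
  define w where "w x = min (u1 x) (u2 x)" for x
  define g where "g x = (if x < y then g1 x else g2 x)" for x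
  have u2_eq: "u2 x = \<alpha> * x" if "x \<le> d" for x
  proof -
    have "\<alpha> * x - (1 - \<beta> * (1 - x)) = (\<beta> - \<alpha>) * (d - x)" using kink by (simp add: algebra_simps)
    moreover have "0 \<le> (\<beta> - \<alpha>) * (d - x)" using that \<alpha> \<beta> by (intro mult_nonneg_nonneg) auto
    ultimately show ?thesis by (simp add: u2_def)
  qed
  have u2_less: "u2 x < x" if "x \<in> ?I" for x
  proof -
    have "x - (1 - \<beta> * (1 - x)) = (\<beta> - 1) * (1 - x)" by (simp add: algebra_simps)
    moreover have "0 < (\<beta> - 1) * (1 - x)" using that \<beta> by simp
    moreover have "\<alpha> * x < x" using that \<alpha> by simp
    ultimately show ?thesis by (simp add: u2_def)
  qed
  \<comment> \<open>Left of \<open>y\<close> the factor \<open>(x / d) powr \<delta>\<close> is below \<open>\<alpha>\<close>, right of \<open>y\<close> above it, and beyond \<open>d\<close> even above 1.\<close>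
  have w1: "w x = u1 x" if x: "0 \<le> x" "x \<le> y" for x
  proof -
    have "(x / d) powr \<delta> \<le> (y / d) powr \<delta>" using x d \<delta> by (intro powr_mono2 divide_right_mono) auto
    hence "x * (x / d) powr \<delta> \<le> x * \<alpha>" using x by (intro mult_left_mono) (auto simp: y_d)
    thus ?thesis using u2_eq[of x] x y by (simp add: w_def u1_def mult.commute)
  qed
  have w2: "w x = u2 x" if x: "y \<le> x" "x \<le> 1" for x
  proof (cases "x \<le> d")
    case True
    have "(y / d) powr \<delta> \<le> (x / d) powr \<delta>" using x y d \<delta> by (intro powr_mono2 divide_right_mono) auto
    hence "x * \<alpha> \<le> x * (x / d) powr \<delta>" using x y by (intro mult_left_mono) (auto simp: y_d)
    thus ?thesis using u2_eq[of x] True by (simp add: w_def u1_def mult.commute)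
  next
    case False
    hence "1 \<le> (x / d) powr \<delta>" using d \<delta> by (intro ge_one_powr_ge_zero) auto
    hence "x * 1 \<le> x * (x / d) powr \<delta>" using x y by (intro mult_left_mono) auto
    moreover have "u2 x \<le> x" using u2_less[of x] x y by (cases "x = 1") (auto simp: u2_def \<alpha> less_imp_le)
    ultimately show ?thesis by (simp add: w_def u1_def)
  qed
  have bw: "bounded_primitive w g"
    unfolding bounded_primitive_def
  proof (intro conjI)
    show "continuous_on {0..1} w" unfolding w_def[abs_def]
      using b1 b2 by (intro continuous_intros) (auto simp: bounded_primitive_def)
    have "{..<y} \<in> sets lebesgue" by simp
    hence "(\<lambda>x. if x \<in> {..<y} then indicator ?I x *\<^sub>R g1 x else indicator ?I x *\<^sub>R g2 x) \<in> borel_measurable lebesgue"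
      using b1 b2 by (intro measurable_If_set) (auto simp: bounded_primitive_def set_borel_measurable_def)
    moreover have "(if x \<in> {..<y} then indicator ?I x *\<^sub>R g1 x else indicator ?I x *\<^sub>R g2 x) = indicator ?I x *\<^sub>R g x" for x
      by (simp add: g_def)
    ultimately show "set_borel_measurable lebesgue ?I g" by (simp add: set_borel_measurable_def)
    obtain M1 M2 where "\<forall>x\<in>?I. \<bar>g1 x\<bar> \<le> M1" "\<forall>x\<in>?I. \<bar>g2 x\<bar> \<le> M2"
      using b1 b2 by (auto simp: bounded_primitive_def)
    thus "\<exists>M. \<forall>x\<in>?I. \<bar>g x\<bar> \<le> M" by (intro exI[of _ "max M1 M2"]) (force simp: g_def)
    obtain S1 S2 where S: "finite S1" "\<forall>x\<in>?I - S1. (u1 has_real_derivative g1 x) (at x)"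
      "finite S2" "\<forall>x\<in>?I - S2. (u2 has_real_derivative g2 x) (at x)"
      using b1 b2 by (auto simp: bounded_primitive_def)
    have "(w has_real_derivative g x) (at x)" if x: "x \<in> ?I - (S1 \<union> S2 \<union> {y})" for x
    proof (cases "x < y")
      case True
      have "(u1 has_real_derivative g1 x) (at x)" using S x by auto
      hence "(w has_real_derivative g1 x) (at x)"
        by (rule has_field_derivative_transform_within_open[where S="{0<..<y}"]) (use x True w1 in auto)
      thus ?thesis using True by (simp add: g_def)
    next
      case False
      have "(u2 has_real_derivative g2 x) (at x)" using S x by auto
      hence "(w has_real_derivative g2 x) (at x)"
        by (rule has_field_derivative_transform_within_open[where S="{y<..<1}"]) (use x False w2 in auto)
      thus ?thesis using False by (simp add: g_def)
    qed
    thus "\<exists>S. finite S \<and> (\<forall>x\<in>?I - S. (w has_real_derivative g x) (at x))"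
      using S by (intro exI[of _ "S1 \<union> S2 \<union> {y}"]) auto
  qed
  have w01: "w 0 = 0" "w 1 = 1" using w1[of 0] w2[of 1] y d \<alpha> by (auto simp: u1_def u2_def)
  have w_less: "w x < x" if "x \<in> ?I" for x using u2_less[OF that] by (simp add: w_def)

  define s where "s = \<delta> * p"
  have s: "0 < s" using \<delta> p by (simp add: s_def)
  define c where "c = (1 + \<delta>) powr p / (1 + s)"
  \<comment> \<open>Strict convexity: on \<open>[0, y]\<close> the convex power has more energy than its chord.\<close>
  have c: "1 < c"
  proof -
    have "1 + p * ((1 + \<delta>) - 1) < (1 + \<delta>) powr p" using \<delta> p by (intro powr_above_tangent_strict) auto
    thus ?thesis using s by (simp add: c_def s_def mult.commute)
  qed
  have gpi: "set_integrable lebesgue ?I (\<lambda>x. \<bar>g x\<bar> powr p)" "set_integrable lebesgue ?I (\<lambda>x. \<bar>g2 x\<bar> powr p)"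
    using bounded_primitive_in_Lp(2)[OF bw, of p] bounded_primitive_in_Lp(2)[OF b2, of p] p by (auto simp: in_Lp_def)
  have sub: "{0<..<y} \<subseteq> ?I" using y d by auto
  \<comment> \<open>The two derivatives differ only left of \<open>y\<close>, where the difference of the energies is explicit.\<close>
  have gain: "(LINT x:?I|lebesgue. \<bar>g x\<bar> powr p - \<bar>g2 x\<bar> powr p) = (c - 1) * \<alpha> powr p * y"
  proof -
    have "(LINT x:?I|lebesgue. \<bar>g x\<bar> powr p - \<bar>g2 x\<bar> powr p)
        = (LINT x:{0<..<y}|lebesgue. - (\<alpha> powr p) + c * ((1 + s) * (x / d) powr s))"
      unfolding set_lebesgue_integral_def
    proof (rule Bochner_Integration.integral_cong[OF refl])
      fix x
      have "\<bar>g x\<bar> powr p - \<bar>g2 x\<bar> powr p = - (\<alpha> powr p) + c * ((1 + s) * (x / d) powr s)" if "x \<in> {0<..<y}"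
        using that y d s \<delta> \<alpha> by (simp add: g_def g1_def g2_def c_def s_def powr_mult powr_powr)
      moreover have "\<bar>g x\<bar> powr p - \<bar>g2 x\<bar> powr p = 0" if "x \<in> ?I" "x \<notin> {0<..<y}"
        using that by (simp add: g_def)
      ultimately show "indicator ?I x *\<^sub>R (\<bar>g x\<bar> powr p - \<bar>g2 x\<bar> powr p)
          = indicator {0<..<y} x *\<^sub>R (- (\<alpha> powr p) + c * ((1 + s) * (x / d) powr s))"
        using sub y d by (auto simp: indicator_def)
    qed
    also have "\<dots> = - (\<alpha> powr p) * (y - 0) + c * (y * (y / d) powr s - 0 * (0 / d) powr s)"
      by (rule set_integral_affine[OF bounded_primitive_power[OF d(1) s]]) (use y d in auto)
    also have "(y / d) powr s = \<alpha> powr p" by (simp add: s_def y_d flip: powr_powr)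
    finally show ?thesis by (simp add: algebra_simps)
  qed
  have "(LINT x:?I|lebesgue. \<bar>g2 x\<bar> powr p) = (LINT x:?I|lebesgue. Q2 * (1 - p) + Q2 * p * g2 x)"
    by (simp add: g2p algebra_simps)
  also have "\<dots> = Q2 * (1 - p) * (1 - 0) + Q2 * p * (u2 1 - u2 0)"
    by (rule set_integral_affine[OF b2]) auto
  also have "\<dots> = Q2" using \<alpha> \<beta> by (simp add: u2_def algebra_simps)
  finally have "(LINT x:?I|lebesgue. \<bar>g x\<bar> powr p) = Q2 + (c - 1) * \<alpha> powr p * y"
    using gain set_integral_diff(2)[OF gpi] by simp
  moreover have "0 < (c - 1) * \<alpha> powr p * y" using c \<alpha>(1) y by simp
  ultimately have energy: "Q2 < (LINT x:?I|lebesgue. \<bar>g x\<bar> powr p)" by simp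

  have "\<not> quasisuperminimizer p Q2 ?I w"
  proof
    assume q: "quasisuperminimizer p Q2 ?I w"
    \<comment> \<open>The competitor \<open>w + \<phi>\<close> is the chord of \<open>w\<close>, with slope 1 and energy 1.\<close>
    define \<phi> where "\<phi> x = x - w x" for x
    have id: "bounded_primitive (\<lambda>x. x) (\<lambda>_. 1)" by (rule bounded_primitiveI_C1) auto
    have "bounded_primitive \<phi> (\<lambda>x. 1 - g x)"
      unfolding \<phi>_def[abs_def] by (rule bounded_primitive_diff[OF id bw])
    hence "\<phi> \<in> W1p_0 p ?I" using w01 p by (intro bounded_primitive_in_W1p_0) (auto simp: \<phi>_def)
    moreover have pos: "0 < \<phi> x" if "x \<in> ?I" for x using w_less[OF that] by (simp add: \<phi>_def)
    ultimately have "(\<integral>\<^sup>+x\<in>{x\<in>?I. \<phi> x \<noteq> 0}. ennreal (norm (weak_grad ?I w x) powr p) \<partial>lebesgue)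
        \<le> ennreal Q2 * (\<integral>\<^sup>+x\<in>{x\<in>?I. \<phi> x \<noteq> 0}. ennreal (norm (weak_grad ?I (\<lambda>y. w y + \<phi> y) x) powr p) \<partial>lebesgue)"
      using q less_imp_le[OF pos] unfolding quasisuperminimizer_def by blast
    moreover have "{x\<in>?I. \<phi> x \<noteq> 0} = ?I" using pos by force
    moreover have "(\<lambda>y. w y + \<phi> y) = (\<lambda>y. y)" by (simp add: \<phi>_def)
    ultimately have "(\<integral>\<^sup>+x\<in>?I. ennreal (norm (weak_grad ?I w x) powr p) \<partial>lebesgue)
        \<le> ennreal Q2 * (\<integral>\<^sup>+x\<in>?I. ennreal (norm (weak_grad ?I (\<lambda>y. y) x) powr p) \<partial>lebesgue)" by simp
    also have "(\<integral>\<^sup>+x\<in>?I. ennreal (norm (weak_grad ?I (\<lambda>y. y) x) powr p) \<partial>lebesgue)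
        = (\<integral>\<^sup>+x\<in>?I. ennreal (\<bar>1\<bar> powr p) \<partial>lebesgue)"
      by (rule nn_integral_weak_grad[OF bounded_primitive_has_weak_gradient[OF id] order_refl])
    also have "\<dots> = 1" by simp
    also have "(\<integral>\<^sup>+x\<in>?I. ennreal (norm (weak_grad ?I w x) powr p) \<partial>lebesgue) = (\<integral>\<^sup>+x\<in>?I. ennreal (\<bar>g x\<bar> powr p) \<partial>lebesgue)"
      by (rule nn_integral_weak_grad[OF bounded_primitive_has_weak_gradient[OF bw] order_refl])
    also have "\<dots> = ennreal (LINT x:?I|lebesgue. \<bar>g x\<bar> powr p)" by (rule nn_set_integral_eq[OF gpi(1)]) simp
    finally show False using energy Q2 by (simp add: ennreal_le_iff)
  qed
  thus ?thesis using q1 q2 unfolding w_def[abs_def] by blast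
qed

end
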